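(* Let $\Gamma$ be a group acting on a graph $X=(V,E)$ via graph automorphisms. Let $\ell\in\mathbb{N}_{>0}$, let $(P,\Phi)$ be a coherent pair of size $\ell$ for $\Gamma\curvearrowright X$, let $\mathcal{W}\colon (E^{or})^\ell\to\mathbb{R}$ be an $\ell$-weight (with respect to $(P,\Phi)$), and let $f_\mathcal{W}\colon V\times V\to\mathbb{R}$ be the associated weight quasimorphism, given by $f_\mathcal{W}(x,y)=\sum_{a\in p^{(\ell)}}\mathcal{W}(a)$ for any $p\in P(x,y)$. Let $\alpha_1\in H_{\Gamma,b}^{n}(X;\mathbb{R})$ and $\alpha_2\in H_{\Gamma,b}^{m}(X;\mathbb{R})$ be $\Phi$-stable classes. Then the cup products $\alpha_1\cup[\delta^1f_\mathcal{W}]\in H_{\Gamma,b}^{n+2}(X;\mathbb{R})$ and $[\delta^1f_{\mathcal{W}}]\cup \alpha_2\in H_{\Gamma,b}^{m+2}(X;\mathbb{R})$ are trivial, and the Massey triple product $\langle \alpha_1, [\delta^1f_\mathcal{W}], \alpha_2 \rangle\subset H_{\Gamma,b}^{n+m+1}(X;\mathbb{R})$ is trivial (i.e., it contains the zero class).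
   Context: Conventions: $\mathbb{N}$ contains $0$. Groups are discrete. Graphs are undirected and simplicial. Equivariant bounded cohomology: for a group $\Gamma$ acting on a set $S$, $\Gamma$ acts on $\ell^\infty(S^{n},\mathbb{R})$ by $(\gamma f)(s_1,\ldots,s_n)=f(\gamma^{-1}s_1,\ldots,\gamma^{-1}s_n)$. Let $C^n_{\Gamma,b}(S;\mathbb{R})=\ell^\infty(S^{n+1},\mathbb{R})^\Gamma$ (bounded $\Gamma$-invariant functions), with the simplicial coboundary operator $\delta^n f(s_0,\ldots,s_{n+1})=\sum_{i=0}^{n+1}(-1)^i f(s_0,\ldots,\widehat{s_i},\ldots,s_{n+1})$; its cohomology is $H^*_{\Gamma,b}(S;\mathbb{R})$. For an action on a graph $X$ with vertex set $V$, $C^*_{\Gamma,b}(X;\mathbb{R}):=C^*_{\Gamma,b}(V;\mathbb{R})$ and $H^*_{\Gamma,b}(X;\mathbb{R}):=H^*_{\Gamma,b}(V;\mathbb{R})$. The cup product is induced by $(f\cup g)(s_0,\ldots,s_{p+q})=f(s_0,\ldots,s_p)\,g(s_p,\ldots,s_{p+q})$. Massey triple product: let $\alpha_1\in H_{\Gamma,b}^p$, $\alpha\in H_{\Gamma,b}^k$, $\alpha_2\in H_{\Gamma,b}^q$ with $\alpha_1\cup\alpha=0$ and $\alpha\cup\alpha_2=0$. Then $\langle\alpha_1,\alpha,\alpha_2\rangle\subset H^{p+q+k-1}_{\Gamma,b}(S;\mathbb{R})$ is the set of all classes $(-1)^k[(-1)^p\omega_1\cup\beta_2-\beta_1\cup\omega_2]$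 where $\omega_1,\omega,\omega_2$ are cocycles representing $\alpha_1,\alpha,\alpha_2$, and $\beta_1,\beta_2$ are bounded $\Gamma$-invariant cochains with $\delta\beta_1=\omega_1\cup\omega$ and $\delta\beta_2=\omega\cup\omega_2$. It is called trivial if it contains the zero class. Quasimorphism of an action: a $\Gamma$-invariant map $f\colon S^2\to\mathbb{R}$ such that $\delta^1f$ is bounded; then $\delta^1 f$ is a cocycle in $C^2_{\Gamma,b}(S;\mathbb{R})$. Under the definitions below, $f_\mathcal{W}$ does not depend on the choice of $p\in P(x,y)$ and is a quasimorphism of $\Gamma\curvearrowright V$. Paths: a path of length $n$ in $X$ is a sequence $v_0,\ldots,v_n$ of distinct vertices with $\{v_j,v_{j+1}\}\in E$ for all $j\in\{0,\ldots,n-1\}$. If $p=v_0,\ldots,v_n$ and $q=w_0,\ldots,w_m$ share no vertex except $v_n=w_0$, then $p*q=v_0,\ldots,v_n,w_1,\ldots,w_m$; the inverse path is $\overline{p}=v_n,\ldots,v_0$. $E^{or}=\{(\alpha,\omega)\in V^2\mid\{\alpha,\omega\}\in E\}$ is the set of oriented edges; $\overline{(\alpha,\omega)}=(\omega,\alpha)$, and for $a=(e_1,\ldots,e_\ell)\in(E^{or})^\ell$, $\overline{a}=(\overline{e_\ell},\ldots,\overline{e_1})$. For such $a$, the head $\alpha(a)$ is the starting vertex of $e_1$ and the tail $\omega(a)$ is the end vertex of $e_\ell$. Fragments: for a path $p=x_0,\ldots,x_n$ with oriented edges $e_i=(x_i,x_{i+1})$, $i\in\{0,\ldots,n-1\}$,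 an $\ell$-fragment of $p$ is a tuple $(e_{i_1},\ldots,e_{i_\ell})$ with $0\leq i_1<\cdots<i_\ell\leq n-1$; $p^{(\ell)}$ is the set of $\ell$-fragments of $p$. A vertex $m$ on $p$ is contained in $a\in p^{(\ell)}$ if $\alpha(a)\neq m\neq\omega(a)$ and $\alpha(a),m,\omega(a)$ appear in this order on $p$. Quasi-median property: for $x,y\in V$ let $P(x,y)\neq\emptyset$ be a set of finite paths from $x$ to $y$. The family $P=(P(x,y))_{x,y\in V}$ fulfils the quasi-median property for $R\in\mathbb{N}$ if for all $x,y,z\in V$ there exist $(m_x,m_y,m_z)\in V^3$ and paths $p_{xy}\in P(x,y)$, $p_{yz}\in P(y,z)$, $p_{xz}\in P(x,z)$ with decompositions $p_{xy}=s_x*r_1*\overline{s_y}$, $p_{yz}=s_y*r_2*\overline{s_z}$, $p_{xz}=s_x*r_3*\overline{s_z}$, where $s_x\in P(x,m_x)$, $s_y\in P(y,m_y)$, $s_z\in P(z,m_z)$, $r_1\in P(m_x,m_y)$, $r_2\in P(m_y,m_z)$, $r_3\in P(m_x,m_z)$, and $r_1,r_2,r_3$ have length at most $R$. It fulfils the quasi-median property if it does so for some $R\in\mathbb{N}$. Coherent pair: $P$ is coherent if it fulfils the quasi-median property and (1) $gP(x,y)=P(gx,gy)$ for all $g\in\Gamma$; (2) $P(x,y)=\overline{P(y,x)}$; (3) every sub-path of a path in $P(x,y)$, from $x'$ to $y'$ say, lies in $P(x',y')$; (4) for all $x,y$ any two paths in $P(x,y)$ have the same length. A coherent pair of size $\ell$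 is a pair $(P,\Phi)$ with $P$ coherent and $\Phi=(\varphi_{p,q})$ a family of bijections $\varphi_{p,q}\colon p^{(\ell)}\to q^{(\ell)}$, one for every $x,y\in V$ and $p,q\in P(x,y)$. $\ell$-weight: a map $\mathcal{W}\colon(E^{or})^\ell\to\mathbb{R}$ that (1) is $\Gamma$-invariant for the diagonal action; (2) is alternating: $\mathcal{W}(\overline{a})=-\mathcal{W}(a)$ for all $a$; (3) is bounded; (4) is path-independent: $\mathcal{W}|_{p^{(\ell)}}=\mathcal{W}|_{q^{(\ell)}}\circ\varphi_{p,q}$ for all $x,y\in V$, $p,q\in P(x,y)$; (5) satisfies: there is $c\in\mathbb{N}_{>1}$ such that for all $x,y\in V$, $p\in P(x,y)$ and all vertices $m$ on $p$, $|\{a\in p^{(\ell)}\mid m\text{ is contained in }a\}\cap\operatorname{supp}(\mathcal{W})|\leq c$, where $\operatorname{supp}(\mathcal{W})=\{a\mid\mathcal{W}(a)\neq0\}$. $\Phi$-stability (relative to $\mathcal{W}$): a map $\tau\colon(E^{or})^\ell\to\mathbb{R}$ is $\Phi$-stable if $\tau(a)=\tau(\varphi_{p,q}(a))$ for all $x,y\in V$, $p,q\in P(x,y)$ and $a\in p^{(\ell)}\cap\operatorname{supp}(\mathcal{W})$. A cochain $\zeta\in C^n_{\Gamma,b}(X;\mathbb{R})$ is $\Phi$-stable if for all $x_1,\ldots,x_n\in V$ the maps $a\mapsto\zeta(\alpha(a),x_1,\ldots,x_n)$ and $a\mapsto\zeta(\omega(a),x_1,\ldots,x_n)$ on $(E^{or})^\ell$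 are $\Phi$-stable. A class in $H^n_{\Gamma,b}(X;\mathbb{R})$ is $\Phi$-stable if it admits a $\Phi$-stable representative cocycle.
   Formalization: The degrees n and m are assumed positive: in degree 0 the claim fails, since the constant class 1 is Φ-stable and 1 ∪ [δ¹f_W] = [δ¹f_W] is nonzero, e.g. for Brooks quasimorphisms of a free group acting on its Cayley tree. *)

theory Defs
  imports Complex_Main "HOL-Algebra.Group_Action" "HOL-Library.Sublist"
begin

section \<open>Equivariant bounded cohomology of an action\<close>

text \<open>
  A group action of \<open>G\<close> on a set \<open>S\<close> is given by \<^locale>\<open>group_action\<close>. A tuple in \<open>S\<^sup>n\<close> is a
  list of length \<open>n\<close>, and a function on \<open>S\<^sup>n\<close> is a function on lists that vanishes on all lists
  outside \<open>S\<^sup>n\<close>, so that equality of functions on \<open>S\<^sup>n\<close> is equality in HOL.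
\<close>

definition tuples :: "'v set \<Rightarrow> nat \<Rightarrow> 'v list set" where
  "tuples S n = {xs. set xs \<subseteq> S \<and> length xs = n}"

definition bounded_cochains ::
  "('g, 'b) monoid_scheme \<Rightarrow> ('g \<Rightarrow> 'v \<Rightarrow> 'v) \<Rightarrow> 'v set \<Rightarrow> nat \<Rightarrow> ('v list \<Rightarrow> real) set" where
  "bounded_cochains G act S n = {f.
     (\<forall>xs. xs \<notin> tuples S (n + 1) \<longrightarrow> f xs = 0) \<and>
     (\<exists>B. \<forall>xs\<in>tuples S (n + 1). \<bar>f xs\<bar> \<le> B) \<and>
     (\<forall>g\<in>carrier G. \<forall>xs\<in>tuples S (n + 1). f (map (act (inv\<^bsub>G\<^esub> g)) xs) = f xs)}"

definition omit_nth :: "nat \<Rightarrow> 'v list \<Rightarrow> 'v list" where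
  "omit_nth i xs = take i xs @ drop (Suc i) xs"

definition coboundary :: "'v set \<Rightarrow> nat \<Rightarrow> ('v list \<Rightarrow> real) \<Rightarrow> 'v list \<Rightarrow> real" where
  "coboundary S n f = (\<lambda>xs. if xs \<in> tuples S (n + 2)
     then \<Sum>i\<in>{0..n + 1}. (- 1) ^ i * f (omit_nth i xs) else 0)"

definition cup :: "'v set \<Rightarrow> nat \<Rightarrow> nat \<Rightarrow> ('v list \<Rightarrow> real) \<Rightarrow> ('v list \<Rightarrow> real) \<Rightarrow> 'v list \<Rightarrow> real" where
  "cup S p q f g = (\<lambda>xs. if xs \<in> tuples S (p + q + 1)
     then f (take (p + 1) xs) * g (drop p xs) else 0)"

definition cocycles ::
  "('g, 'b) monoid_scheme \<Rightarrow> ('g \<Rightarrow> 'v \<Rightarrow> 'v) \<Rightarrow> 'v set \<Rightarrow> nat \<Rightarrow> ('v list \<Rightarrow> real) set" where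
  "cocycles G act S n = {f \<in> bounded_cochains G act S n. coboundary S n f = (\<lambda>_. 0)}"

fun coboundaries ::
  "('g, 'b) monoid_scheme \<Rightarrow> ('g \<Rightarrow> 'v \<Rightarrow> 'v) \<Rightarrow> 'v set \<Rightarrow> nat \<Rightarrow> ('v list \<Rightarrow> real) set" where
  "coboundaries G act S 0 = {\<lambda>_. 0}"
| "coboundaries G act S (Suc n) = coboundary S n ` bounded_cochains G act S n"

definition cohomologous ::
  "('g, 'b) monoid_scheme \<Rightarrow> ('g \<Rightarrow> 'v \<Rightarrow> 'v) \<Rightarrow> 'v set \<Rightarrow> nat \<Rightarrow> ('v list \<Rightarrow> real) rel" where
  "cohomologous G act S n = {(f, g). f \<in> cocycles G act S n \<and> g \<in> cocycles G act S n \<and>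
     (\<lambda>xs. f xs - g xs) \<in> coboundaries G act S n}"

definition cohomology ::
  "('g, 'b) monoid_scheme \<Rightarrow> ('g \<Rightarrow> 'v \<Rightarrow> 'v) \<Rightarrow> 'v set \<Rightarrow> nat \<Rightarrow> ('v list \<Rightarrow> real) set set" where
  "cohomology G act S n = cocycles G act S n // cohomologous G act S n"

definition cohomology_class ::
  "('g, 'b) monoid_scheme \<Rightarrow> ('g \<Rightarrow> 'v \<Rightarrow> 'v) \<Rightarrow> 'v set \<Rightarrow> nat \<Rightarrow> ('v list \<Rightarrow> real) \<Rightarrow> ('v list \<Rightarrow> real) set" where
  "cohomology_class G act S n f = cohomologous G act S n `` {f}"

abbreviation trivial_class ::
  "('g, 'b) monoid_scheme \<Rightarrow> ('g \<Rightarrow> 'v \<Rightarrow> 'v) \<Rightarrow> 'v set \<Rightarrow> nat \<Rightarrow> ('v list \<Rightarrow> real) set" where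
  "trivial_class G act S n \<equiv> cohomology_class G act S n (\<lambda>_. 0)"

text \<open>By the Leibniz rule, all members of the following union are the same class.\<close>

definition cup_class ::
  "('g, 'b) monoid_scheme \<Rightarrow> ('g \<Rightarrow> 'v \<Rightarrow> 'v) \<Rightarrow> 'v set \<Rightarrow> nat \<Rightarrow> nat \<Rightarrow>
   ('v list \<Rightarrow> real) set \<Rightarrow> ('v list \<Rightarrow> real) set \<Rightarrow> ('v list \<Rightarrow> real) set" where
  "cup_class G act S p q A B =
     (\<Union>f\<in>A. \<Union>g\<in>B. cohomology_class G act S (p + q) (cup S p q f g))"

text \<open>
  Elements of a class are its representing cocycles. Since degrees are natural numbers, the
  definition is meaningful only for \<open>p + k > 0\<close> and \<open>k + q > 0\<close>.
\<close>

definition massey_product ::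
  "('g, 'b) monoid_scheme \<Rightarrow> ('g \<Rightarrow> 'v \<Rightarrow> 'v) \<Rightarrow> 'v set \<Rightarrow> nat \<Rightarrow> nat \<Rightarrow> nat \<Rightarrow>
   ('v list \<Rightarrow> real) set \<Rightarrow> ('v list \<Rightarrow> real) set \<Rightarrow> ('v list \<Rightarrow> real) set \<Rightarrow>
   ('v list \<Rightarrow> real) set set" where
  "massey_product G act S p k q A1 A A2 =
     {cohomology_class G act S (p + q + k - 1)
        (\<lambda>xs. (- 1) ^ k * ((- 1) ^ p * cup S p (k + q - 1) w1 b2 xs - cup S (p + k - 1) q b1 w2 xs))
      | w1 w w2 b1 b2.
        w1 \<in> A1 \<and> w \<in> A \<and> w2 \<in> A2 \<and>
        b1 \<in> bounded_cochains G act S (p + k - 1) \<and>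
        b2 \<in> bounded_cochains G act S (k + q - 1) \<and>
        coboundary S (p + k - 1) b1 = cup S p k w1 w \<and>
        coboundary S (k + q - 1) b2 = cup S k q w w2}"


section \<open>Graphs, paths and fragments\<close>

definition simple_graph :: "'v set \<Rightarrow> 'v set set \<Rightarrow> bool" where
  "simple_graph V E \<longleftrightarrow> (\<forall>e\<in>E. \<exists>x y. x \<in> V \<and> y \<in> V \<and> x \<noteq> y \<and> e = {x, y})"

definition acts_on_graph ::
  "('g, 'b) monoid_scheme \<Rightarrow> ('g \<Rightarrow> 'v \<Rightarrow> 'v) \<Rightarrow> 'v set \<Rightarrow> 'v set set \<Rightarrow> bool" where
  "acts_on_graph G act V E \<longleftrightarrow> group_action G V act \<and>
     (\<forall>g\<in>carrier G. \<forall>x\<in>V. \<forall>y\<in>V. {x, y} \<in> E \<longleftrightarrow> {act g x, act g y} \<in> E)"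

definition oriented_edges :: "'v set set \<Rightarrow> ('v \<times> 'v) set" where
  "oriented_edges E = {(x, y). {x, y} \<in> E}"

text \<open>The vertex list of a path is nonempty; a path of length \<open>n\<close> has \<open>n + 1\<close> vertices.\<close>

definition is_path :: "'v set \<Rightarrow> 'v set set \<Rightarrow> 'v list \<Rightarrow> bool" where
  "is_path V E p \<longleftrightarrow> p \<noteq> [] \<and> set p \<subseteq> V \<and> distinct p \<and>
     (\<forall>j. Suc j < length p \<longrightarrow> {p ! j, p ! Suc j} \<in> E)"

definition path_length :: "'v list \<Rightarrow> nat" where
  "path_length p = length p - 1"

definition composable :: "'v list \<Rightarrow> 'v list \<Rightarrow> bool" where
  "composable p q \<longleftrightarrow> p \<noteq> [] \<and> q \<noteq> [] \<and> last p = hd q \<and> set p \<inter> set q = {last p}"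

definition path_concat :: "'v list \<Rightarrow> 'v list \<Rightarrow> 'v list" where
  "path_concat p q = p @ tl q"

definition decomposes :: "'v list \<Rightarrow> 'v list \<Rightarrow> 'v list \<Rightarrow> 'v list \<Rightarrow> bool" where
  "decomposes p s r t \<longleftrightarrow> composable s r \<and> composable (path_concat s r) t \<and>
     p = path_concat (path_concat s r) t"

definition edge_tuples :: "'v set set \<Rightarrow> nat \<Rightarrow> ('v \<times> 'v) list set" where
  "edge_tuples E l = {a. set a \<subseteq> oriented_edges E \<and> length a = l}"

definition edge_tuple_inverse :: "('v \<times> 'v) list \<Rightarrow> ('v \<times> 'v) list" where
  "edge_tuple_inverse a = rev (map prod.swap a)"

definition head :: "('v \<times> 'v) list \<Rightarrow> 'v" where
  "head a = fst (hd a)"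

definition tail :: "('v \<times> 'v) list \<Rightarrow> 'v" where
  "tail a = snd (last a)"

definition fragments :: "nat \<Rightarrow> 'v list \<Rightarrow> ('v \<times> 'v) list set" where
  "fragments l p = {map (\<lambda>i. (p ! i, p ! Suc i)) is | is.
     length is = l \<and> sorted_wrt (<) is \<and> (\<forall>i\<in>set is. i < path_length p)}"

definition contained_in :: "'v list \<Rightarrow> 'v \<Rightarrow> ('v \<times> 'v) list \<Rightarrow> bool" where
  "contained_in p m a \<longleftrightarrow> head a \<noteq> m \<and> m \<noteq> tail a \<and>
     (\<exists>i j k. i \<le> j \<and> j \<le> k \<and> k < length p \<and> p ! i = head a \<and> p ! j = m \<and> p ! k = tail a)"


section \<open>Coherent pairs, weights and stability\<close>

type_synonym 'v path_family = "'v \<Rightarrow> 'v \<Rightarrow> 'v list set"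
type_synonym 'v fragment_family =
  "'v list \<Rightarrow> 'v list \<Rightarrow> ('v \<times> 'v) list \<Rightarrow> ('v \<times> 'v) list"

definition path_family :: "'v set \<Rightarrow> 'v set set \<Rightarrow> 'v path_family \<Rightarrow> bool" where
  "path_family V E P \<longleftrightarrow> (\<forall>x\<in>V. \<forall>y\<in>V. P x y \<noteq> {} \<and>
     (\<forall>p\<in>P x y. is_path V E p \<and> hd p = x \<and> last p = y))"

definition quasi_median_for :: "'v set \<Rightarrow> 'v path_family \<Rightarrow> nat \<Rightarrow> bool" where
  "quasi_median_for V P R \<longleftrightarrow> (\<forall>x\<in>V. \<forall>y\<in>V. \<forall>z\<in>V.
     \<exists>mx\<in>V. \<exists>my\<in>V. \<exists>mz\<in>V.
     \<exists>pxy\<in>P x y. \<exists>pyz\<in>P y z. \<exists>pxz\<in>P x z.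
     \<exists>sx\<in>P x mx. \<exists>sy\<in>P y my. \<exists>sz\<in>P z mz.
     \<exists>r1\<in>P mx my. \<exists>r2\<in>P my mz. \<exists>r3\<in>P mx mz.
       decomposes pxy sx r1 (rev sy) \<and>
       decomposes pyz sy r2 (rev sz) \<and>
       decomposes pxz sx r3 (rev sz) \<and>
       path_length r1 \<le> R \<and> path_length r2 \<le> R \<and> path_length r3 \<le> R)"

definition coherent ::
  "('g, 'b) monoid_scheme \<Rightarrow> ('g \<Rightarrow> 'v \<Rightarrow> 'v) \<Rightarrow> 'v set \<Rightarrow> 'v set set \<Rightarrow> 'v path_family \<Rightarrow> bool" where
  "coherent G act V E P \<longleftrightarrow>
     path_family V E P \<and>
     (\<exists>R. quasi_median_for V P R) \<and>
     (\<forall>g\<in>carrier G. \<forall>x\<in>V. \<forall>y\<in>V. map (act g) ` P x y = P (act g x) (act g y)) \<and>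
     (\<forall>x\<in>V. \<forall>y\<in>V. P x y = rev ` P y x) \<and>
     (\<forall>x\<in>V. \<forall>y\<in>V. \<forall>p\<in>P x y. \<forall>q. q \<noteq> [] \<and> sublist q p \<longrightarrow> q \<in> P (hd q) (last q)) \<and>
     (\<forall>x\<in>V. \<forall>y\<in>V. \<forall>p\<in>P x y. \<forall>q\<in>P x y. path_length p = path_length q)"

definition coherent_pair ::
  "('g, 'b) monoid_scheme \<Rightarrow> ('g \<Rightarrow> 'v \<Rightarrow> 'v) \<Rightarrow> 'v set \<Rightarrow> 'v set set \<Rightarrow> nat \<Rightarrow>
   'v path_family \<Rightarrow> 'v fragment_family \<Rightarrow> bool" where
  "coherent_pair G act V E l P Phi \<longleftrightarrow> coherent G act V E P \<and>
     (\<forall>x\<in>V. \<forall>y\<in>V. \<forall>p\<in>P x y. \<forall>q\<in>P x y. bij_betw (Phi p q) (fragments l p) (fragments l q))"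

text \<open>
  Only the values of a weight on \<^const>\<open>edge_tuples\<close> matter; likewise for the maps \<open>\<tau>\<close> in
  the definition of stability.
\<close>

definition weight_supp :: "'v set set \<Rightarrow> nat \<Rightarrow> (('v \<times> 'v) list \<Rightarrow> real) \<Rightarrow> ('v \<times> 'v) list set" where
  "weight_supp E l W = {a \<in> edge_tuples E l. W a \<noteq> 0}"

definition is_weight ::
  "('g, 'b) monoid_scheme \<Rightarrow> ('g \<Rightarrow> 'v \<Rightarrow> 'v) \<Rightarrow> 'v set \<Rightarrow> 'v set set \<Rightarrow> nat \<Rightarrow>
   'v path_family \<Rightarrow> 'v fragment_family \<Rightarrow> (('v \<times> 'v) list \<Rightarrow> real) \<Rightarrow> bool" where
  "is_weight G act V E l P Phi W \<longleftrightarrow>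
     (\<forall>g\<in>carrier G. \<forall>a\<in>edge_tuples E l. W (map (map_prod (act g) (act g)) a) = W a) \<and>
     (\<forall>a\<in>edge_tuples E l. W (edge_tuple_inverse a) = - W a) \<and>
     (\<exists>B. \<forall>a\<in>edge_tuples E l. \<bar>W a\<bar> \<le> B) \<and>
     (\<forall>x\<in>V. \<forall>y\<in>V. \<forall>p\<in>P x y. \<forall>q\<in>P x y. \<forall>a\<in>fragments l p. W a = W (Phi p q a)) \<and>
     (\<exists>c::nat. c > 1 \<and> (\<forall>x\<in>V. \<forall>y\<in>V. \<forall>p\<in>P x y. \<forall>m\<in>set p.
        card ({a \<in> fragments l p. contained_in p m a} \<inter> weight_supp E l W) \<le> c))"

text \<open>The value does not depend on the chosen path, see \<open>weight_qm_eq\<close> below.\<close>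

definition weight_qm ::
  "nat \<Rightarrow> 'v path_family \<Rightarrow> (('v \<times> 'v) list \<Rightarrow> real) \<Rightarrow> 'v \<Rightarrow> 'v \<Rightarrow> real" where
  "weight_qm l P W x y = (\<Sum>a\<in>fragments l (SOME p. p \<in> P x y). W a)"

definition weight_cocycle ::
  "'v set \<Rightarrow> nat \<Rightarrow> 'v path_family \<Rightarrow> (('v \<times> 'v) list \<Rightarrow> real) \<Rightarrow> 'v list \<Rightarrow> real" where
  "weight_cocycle V l P W = coboundary V 1 (\<lambda>xs. weight_qm l P W (xs ! 0) (xs ! 1))"

definition stable_map ::
  "'v set \<Rightarrow> 'v set set \<Rightarrow> nat \<Rightarrow> 'v path_family \<Rightarrow> 'v fragment_family \<Rightarrow>
   (('v \<times> 'v) list \<Rightarrow> real) \<Rightarrow> (('v \<times> 'v) list \<Rightarrow> real) \<Rightarrow> bool" where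
  "stable_map V E l P Phi W \<tau> \<longleftrightarrow>
     (\<forall>x\<in>V. \<forall>y\<in>V. \<forall>p\<in>P x y. \<forall>q\<in>P x y. \<forall>a\<in>fragments l p \<inter> weight_supp E l W.
        \<tau> a = \<tau> (Phi p q a))"

definition stable_cochain ::
  "'v set \<Rightarrow> 'v set set \<Rightarrow> nat \<Rightarrow> 'v path_family \<Rightarrow> 'v fragment_family \<Rightarrow>
   (('v \<times> 'v) list \<Rightarrow> real) \<Rightarrow> nat \<Rightarrow> ('v list \<Rightarrow> real) \<Rightarrow> bool" where
  "stable_cochain V E l P Phi W n \<zeta> \<longleftrightarrow> (\<forall>xs\<in>tuples V n.
     stable_map V E l P Phi W (\<lambda>a. \<zeta> (head a # xs)) \<and>
     stable_map V E l P Phi W (\<lambda>a. \<zeta> (tail a # xs)))"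

definition stable_class ::
  "'v set \<Rightarrow> 'v set set \<Rightarrow> nat \<Rightarrow> 'v path_family \<Rightarrow> 'v fragment_family \<Rightarrow>
   (('v \<times> 'v) list \<Rightarrow> real) \<Rightarrow> nat \<Rightarrow> ('v list \<Rightarrow> real) set \<Rightarrow> bool" where
  "stable_class V E l P Phi W n A \<longleftrightarrow> (\<exists>\<zeta>\<in>A. stable_cochain V E l P Phi W n \<zeta>)"

lemma weight_qm_eq:
  assumes "coherent_pair G act V E l P Phi" "is_weight G act V E l P Phi W"
    and "x \<in> V" "y \<in> V" "p \<in> P x y"
  shows "weight_qm l P W x y = (\<Sum>a\<in>fragments l p. W a)"
proof -
  define q where "q = (SOME p. p \<in> P x y)"
  have q: "q \<in> P x y"
    unfolding q_def using assms(5) by (rule someI)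
  have bij: "bij_betw (Phi p q) (fragments l p) (fragments l q)"
    using assms q unfolding coherent_pair_def by blast
  have "W a = W (Phi p q a)" if "a \<in> fragments l p" for a
    using assms q that unfolding is_weight_def by blast
  then have "(\<Sum>a\<in>fragments l p. W a) = (\<Sum>a\<in>fragments l p. W (Phi p q a))"
    by (rule sum.cong[OF refl])
  also have "\<dots> = (\<Sum>a\<in>fragments l q. W a)"
    by (rule sum.reindex_bij_betw[OF bij])
  finally show ?thesis
    unfolding weight_qm_def q_def by simp
qed

end

(*
Summing W over the fragments of a path, with each fragment a multiplied by the mean of the values
of a stable cocycle at the two ends of a, gives an unbounded invariant cochain. Its coboundary is,
up to a term that the quasi-median property bounds, the cup product of the cocycle with the
quasimorphism; this makes both cup products with the class of the weight quasimorphism coboundaries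
of bounded cochains. Twisting the sum by two stable cocycles at once, one in its last and one in its
first argument, bounds in the same way a primitive of the Massey cocycle. Stability is a
condition on the first argument only, so the cocycle on the left is first reversed, which does not
change its class.
*)

theory Submission
  imports Defs
begin

subsection \<open>The simplicial differential on functions of lists\<close>

text \<open>The obvious primitive, a cocycle \<open>w\<close> cupped with the quasimorphism, has the
  right coboundary up to sign but is in general unbounded. The cure rests on the cocycle identity:
  \<open>w\<close> with one argument frozen at a vertex \<open>x\<close> is, up to sign, a primitive
  of \<open>w\<close>, whatever \<open>x\<close> is. Hence \<open>x\<close> may vary with the
  fragment. When the twisted sum is differentiated, the fragment drops out of the twisting factor;
  what is left is \<open>w\<close> times the plain sum and a triangle defect of the twisted sum.
  Correcting the obvious primitive by the coboundary of the twisted sum therefore leaves just the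
  defect. In the Massey cocycle the triple products through the quasimorphism cancel. The rest is
  visibly the coboundary of something unbounded, and the doubly twisted sum corrects this in the
  same manner. There the fragment sits between the tuples of the two cocycles, so the left one has
  to be frozen in its last argument and the right one in its first.\<close>

fun diff :: "('v list \<Rightarrow> real) \<Rightarrow> 'v list \<Rightarrow> real" where
  "diff f [] = 0"
| "diff f (x # xs) = f xs - diff (\<lambda>ys. f (x # ys)) xs"

text \<open>Links the alternating sum in \<open>coboundary\<close> to the recursion on the first
  entry, which lets the identities below go by list induction with \<open>f\<close> generalised,
  without reindexing sums.\<close>

lemma diff_eq_sum: "diff f xs = (\<Sum>i<length xs. (- 1) ^ i * f (omit_nth i xs))"
proof (induction xs arbitrary: f)
  case (Cons x xs)
  have "(\<Sum>i<length (x # xs). (- 1) ^ i * f (omit_nth i (x # xs)))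
      = f xs + (\<Sum>i<length xs. (- 1) ^ Suc i * f (omit_nth (Suc i) (x # xs)))"
    by (simp only: length_Cons sum.lessThan_Suc_shift) (simp add: omit_nth_def)
  also have "\<dots> = f xs - (\<Sum>i<length xs. (- 1) ^ i * f (x # omit_nth i xs))"
    by (simp add: omit_nth_def sum_negf)
  finally show ?case using Cons by simp
qed simp

lemma coboundary_eq_diff: "coboundary S n f xs = (if xs \<in> tuples S (n + 2) then diff f xs else 0)"
proof -
  have "{0..n + 1} = {..<n + 2}" by auto
  then show ?thesis by (simp add: coboundary_def diff_eq_sum tuples_def)
qed

lemma diff_cong:
  assumes "\<And>ys. set ys \<subseteq> set xs \<Longrightarrow> Suc (length ys) = length xs \<Longrightarrow> f ys = g ys"
  shows "diff f xs = diff g xs"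
  using assms
proof (induction xs arbitrary: f g)
  case (Cons x xs)
  have "diff (\<lambda>ys. f (x # ys)) xs = diff (\<lambda>ys. g (x # ys)) xs"
    by (rule Cons.IH) (rule Cons.prems, auto)
  then show ?case using Cons.prems[of xs] by auto
qed simp

lemma diff_add: "diff (\<lambda>xs. f xs + g xs) xs = diff f xs + diff g xs"
  by (induction xs arbitrary: f g) auto

lemma diff_minus: "diff (\<lambda>xs. f xs - g xs) xs = diff f xs - diff g xs"
  by (induction xs arbitrary: f g) auto

lemma diff_cmult: "diff (\<lambda>xs. c * f xs) xs = c * diff f xs"
  by (induction xs arbitrary: f) (auto simp: algebra_simps)

lemma diff_cmult_right: "diff (\<lambda>xs. f xs * c) xs = diff f xs * c"
  by (induction xs arbitrary: f) (auto simp: algebra_simps)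

lemma diff_bound:
  fixes B :: real
  assumes "\<And>xs. \<bar>f xs\<bar> \<le> B"
  shows "\<bar>diff f xs\<bar> \<le> length xs * B"
  using assms
proof (induction xs arbitrary: f)
  case (Cons x xs)
  have "\<bar>diff (\<lambda>ys. f (x # ys)) xs\<bar> \<le> length xs * B"
    by (rule Cons.IH) (rule Cons.prems)
  then show ?case using Cons.prems[of xs] by (simp add: algebra_simps)
qed simp

lemma diff_zero: "diff (\<lambda>_. 0) xs = 0"
  by (induction xs) auto

lemma diff_sum: "diff (\<lambda>xs. \<Sum>a\<in>A. f a xs) xs = (\<Sum>a\<in>A. diff (f a) xs)"
  by (induction xs arbitrary: f) (auto simp: sum_subtractf)

lemma diff_diff: "diff (diff f) xs = 0"
  by (induction xs arbitrary: f) (auto simp: diff_minus)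

lemma diff_snoc:
  "diff f (xs @ [a]) = diff (\<lambda>ys. f (ys @ [a])) xs + (- 1) ^ length xs * f xs"
  by (induction xs arbitrary: f) auto

text \<open>Only the face that omits \<open>v\<close> has a different last entry, and for empty
  \<open>ys\<close> it would have none.\<close>

lemma diff_last:
  assumes "ys \<noteq> []"
  shows "diff (\<lambda>zs. h zs (last zs)) (ys @ [v])
    = diff (\<lambda>zs. h zs v) (ys @ [v]) + (- 1) ^ length ys * (h ys (last ys) - h ys v)"
  by (simp add: diff_snoc algebra_simps)

lemma diff_hd:
  "diff (\<lambda>zs. h zs (hd zs)) (v # zs)
    = diff (\<lambda>zs. h zs v) (v # zs) + h zs (hd zs) - h zs v"
  by simp

text \<open>Omitting an index up to \<open>n\<close> gives a face of the front block
  \<open>take (Suc n) xs\<close>; omitting an index from \<open>n\<close> on gives a face of the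
  back block \<open>drop n xs\<close>. The face that omits index \<open>n\<close> occurs in both
  sums, so one copy is subtracted.\<close>

lemma diff_split:
  assumes "n < length xs"
  shows "diff (\<lambda>ys. h (take n ys) (drop n ys)) xs
    = diff (\<lambda>ys. h ys (drop (Suc n) xs)) (take (Suc n) xs)
      + (- 1) ^ n * (diff (\<lambda>zs. h (take n xs) zs) (drop n xs) - h (take n xs) (drop (Suc n) xs))"
  using assms
proof (induction n arbitrary: xs h)
  case 0
  then show ?case by (cases xs) auto
next
  case (Suc n)
  then obtain x ys where xs: "xs = x # ys" by (cases xs) auto
  have n: "n < length ys" using Suc.prems xs by simp
  show ?case
    using Suc.IH[OF n, of "\<lambda>us. h (x # us)"] by (simp add: xs algebra_simps)
qed

text \<open>The Leibniz rule. The blocks overlap in one entry; the last face of the front and the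
  first face of the back both give \<open>f (take (Suc p) xs) * g (drop (Suc p) xs)\<close>, with
  opposite signs.\<close>

lemma diff_cup:
  assumes "p + 2 \<le> length xs"
  shows "diff (\<lambda>ys. f (take (Suc p) ys) * g (drop p ys)) xs
    = diff f (take (Suc (Suc p)) xs) * g (drop (Suc p) xs)
      + (- 1) ^ p * (f (take (Suc p) xs) * diff g (drop p xs))"
  using assms
proof (induction p arbitrary: xs f)
  case 0
  then obtain x y ys where "xs = x # y # ys" by (cases xs; cases "tl xs") auto
  then show ?case by (simp add: diff_cmult algebra_simps)
next
  case (Suc p)
  then obtain x ys where xs: "xs = x # ys" by (cases xs) auto
  have "p + 2 \<le> length ys" using Suc.prems xs by simp
  note IH = Suc.IH[OF this, of "\<lambda>us. f (x # us)"]
  show ?case using IH by (simp add: xs algebra_simps)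
qed

subsection \<open>Reversal of tuples\<close>

text \<open>The sign of the permutation that reverses \<open>k\<close> entries: moving the first of
  \<open>k + 1\<close> entries to the end takes \<open>k\<close> transpositions.\<close>

fun rev_sign :: "nat \<Rightarrow> real" where
  "rev_sign 0 = 1"
| "rev_sign (Suc k) = (- 1) ^ k * rev_sign k"

lemma abs_rev_sign: "\<bar>rev_sign k\<bar> = 1"
  by (induction k) (auto simp: abs_mult power_abs)

lemma diff_rev:
  assumes "length xs = Suc k"
  shows "diff (\<lambda>ys. f (rev ys)) xs = (- 1) ^ k * diff f (rev xs)"
  using assms
proof (induction k arbitrary: xs f)
  case 0
  then show ?case by (cases xs) auto
next
  case (Suc k)
  then obtain x ys where xs: "xs = x # ys" "length ys = Suc k" by (cases xs) auto
  have "((- 1) ^ k * (- 1) ^ k :: real) = 1"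
    by (simp flip: power_add add: mult_2[symmetric])
  then show ?case
    using Suc.IH[OF xs(2), of "\<lambda>us. f (us @ [x])"] xs
    by (simp add: diff_snoc algebra_simps)
qed

text \<open>
  The prism with simplices \<open>(x\<^sub>0, \<dots>, x\<^sub>i, x\<^sub>n, \<dots>, x\<^sub>i)\<close> joins a tuple to its reversal.
\<close>

fun rev_prism :: "('v list \<Rightarrow> real) \<Rightarrow> 'v list \<Rightarrow> real" where
  "rev_prism f [] = 0"
| "rev_prism f (x # xs) =
     rev_sign (Suc (length xs)) * f (x # rev xs @ [x]) - rev_prism (\<lambda>ys. f (x # ys)) xs"

lemma rev_prism_minus: "rev_prism (\<lambda>xs. f xs - g xs) xs = rev_prism f xs - rev_prism g xs"
  by (induction xs arbitrary: f g) (auto simp: algebra_simps)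

lemma rev_prism_zero:
  assumes "\<And>ys. set ys \<subseteq> set xs \<Longrightarrow> length ys = Suc (length xs) \<Longrightarrow> f ys = 0"
  shows "rev_prism f xs = 0"
  using assms
proof (induction xs arbitrary: f)
  case (Cons x xs)
  have "rev_prism (\<lambda>ys. f (x # ys)) xs = 0"
    by (rule Cons.IH) (rule Cons.prems, auto)
  then show ?case using Cons.prems[of "x # rev xs @ [x]"] by auto
qed simp

text \<open>The prism is a chain homotopy from the identity to signed reversal. In the inductive
  step, the face of \<open>x # rev xs @ [x]\<close> without its first entry is the reversal of
  \<open>x # xs\<close>; the face without its last entry cancels the reversed term that the
  induction hypothesis gives for \<open>f\<close> with \<open>x\<close> in front; the middle faces
  cancel against \<open>rev_prism (diff f)\<close>.\<close>

lemma diff_rev_prism: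
  "diff (rev_prism f) xs + rev_prism (diff f) xs = rev_sign (length xs) * f (rev xs) - f xs"
proof (induction xs arbitrary: f)
  case (Cons x xs)
  define g where "g = (\<lambda>ys. f (x # ys @ [x]))"
  define k where "k = length xs"
  \<comment> \<open>Every face of \<open>xs\<close> has one entry fewer than \<open>xs\<close>, so
    the sign is the constant \<open>rev_sign k\<close>.\<close>
  have "diff (\<lambda>ys. rev_sign (Suc (length ys)) * g (rev ys)) xs
      = diff (\<lambda>ys. rev_sign k * g (rev ys)) xs"
    by (rule diff_cong) (simp add: k_def flip: rev_sign.simps)
  also have "\<dots> = - (rev_sign (Suc k) * diff g (rev xs))"
  proof (cases xs)
    case (Cons y ys)
    then show ?thesis
      using diff_rev[of xs "length ys" g] by (simp add: diff_cmult k_def del: diff.simps(2) rev.simps)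
  qed simp
  finally have *: "diff (\<lambda>ys. rev_sign (Suc (length ys)) * g (rev ys)) xs
      = - (rev_sign (Suc k) * diff g (rev xs))" .
  have sq: "((- 1) ^ k * (- 1) ^ k :: real) = 1"
    by (simp flip: power_add add: mult_2[symmetric])
  have sq': "(- 1) ^ k * ((- 1) ^ k * r) = r" for r :: real
    using sq by (simp flip: mult.assoc)
  have "diff (rev_prism f) (x # xs) + rev_prism (diff f) (x # xs)
     = rev_sign (Suc k) * f (rev xs @ [x]) - rev_sign (Suc k) * (-1) ^ k * f (x # rev xs)
       + (diff (rev_prism (\<lambda>ys. f (x # ys))) xs + rev_prism (diff (\<lambda>ys. f (x # ys))) xs)"
    using * by (simp add: diff_minus rev_prism_minus diff_snoc g_def k_def algebra_simps)
  then show ?case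
    unfolding Cons.IH by (simp add: k_def[symmetric] algebra_simps sq')
qed simp

lemma rev_prism_bound:
  fixes B :: real
  assumes "\<And>ys. set ys \<subseteq> set xs \<Longrightarrow> length ys = Suc (length xs) \<Longrightarrow> \<bar>f ys\<bar> \<le> B"
  shows "\<bar>rev_prism f xs\<bar> \<le> length xs * B"
  using assms
proof (induction xs arbitrary: f)
  case (Cons x xs)
  have "\<bar>rev_prism (\<lambda>ys. f (x # ys)) xs\<bar> \<le> length xs * B"
    by (rule Cons.IH) (rule Cons.prems, auto)
  moreover have "\<bar>rev_sign (Suc (length xs)) * f (x # rev xs @ [x])\<bar> \<le> B"
    unfolding abs_mult abs_rev_sign using Cons.prems[of "x # rev xs @ [x]"] by auto
  ultimately show ?case
    by (simp add: algebra_simps)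
qed simp

lemma rev_prism_map: "rev_prism f (map h xs) = rev_prism (\<lambda>ys. f (map h ys)) xs"
  by (induction xs arbitrary: f) (auto simp: rev_map)

lemma rev_prism_cong:
  assumes "\<And>ys. set ys \<subseteq> set xs \<Longrightarrow> length ys = Suc (length xs) \<Longrightarrow> f ys = g ys"
  shows "rev_prism f xs = rev_prism g xs"
  using rev_prism_zero[of xs "\<lambda>ys. f ys - g ys"] assms by (simp add: rev_prism_minus)

lemma diff_map: "diff f (map h xs) = diff (\<lambda>ys. f (map h ys)) xs"
  by (induction xs arbitrary: f) auto

subsection \<open>Cochains, classes and cup products\<close>

text \<open>Cochains must vanish off the tuples of their degree. This turns any function on lists
  into such a function, and by \<open>coboundary_restrict\<close> the coboundary does not notice the
  cut. The degree is \<open>n\<close>, hence \<open>n + 1\<close> entries.\<close>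

definition restrict_tuples :: "'v set \<Rightarrow> nat \<Rightarrow> ('v list \<Rightarrow> real) \<Rightarrow> 'v list \<Rightarrow> real" where
  "restrict_tuples S n F = (\<lambda>xs. if xs \<in> tuples S (Suc n) then F xs else 0)"

lemma coboundary_eq_restrict: "coboundary S n F = restrict_tuples S (Suc n) (diff F)"
  by (auto simp: coboundary_eq_diff restrict_tuples_def)

lemma diff_cong_tuples:
  assumes "xs \<in> tuples S (Suc n)" "\<And>ys. ys \<in> tuples S n \<Longrightarrow> f ys = g ys"
  shows "diff f xs = diff g xs"
  by (rule diff_cong) (use assms in \<open>auto simp: tuples_def\<close>)

lemma coboundary_restrict: "coboundary S n (restrict_tuples S n F) = coboundary S n F"
proof
  fix xs
  show "coboundary S n (restrict_tuples S n F) xs = coboundary S n F xs"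
    using diff_cong_tuples[of xs S "Suc n" "restrict_tuples S n F" F]
    by (auto simp: coboundary_eq_diff restrict_tuples_def)
qed

lemma coboundary_coboundary: "coboundary S (Suc n) (coboundary S n F) = (\<lambda>_. 0)"
  unfolding coboundary_eq_restrict[of S n F] coboundary_restrict
  by (auto simp: coboundary_eq_diff diff_diff)

lemma coboundary_minus:
  "coboundary S n (\<lambda>xs. f xs - g xs) = (\<lambda>xs. coboundary S n f xs - coboundary S n g xs)"
  by (auto simp: coboundary_eq_diff diff_minus)

lemma coboundary_add:
  "coboundary S n (\<lambda>xs. f xs + g xs) = (\<lambda>xs. coboundary S n f xs + coboundary S n g xs)"
  by (auto simp: coboundary_eq_diff diff_add)

lemma coboundary_cmult: "coboundary S n (\<lambda>xs. c * f xs) = (\<lambda>xs. c * coboundary S n f xs)"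
  by (auto simp: coboundary_eq_diff diff_cmult)

lemma coboundary_cup:
  "coboundary S (p + q) (cup S p q f g) = (\<lambda>xs.
     cup S (Suc p) q (coboundary S p f) g xs + (- 1) ^ p * cup S p (Suc q) f (coboundary S q g) xs)"
proof
  fix xs
  show "coboundary S (p + q) (cup S p q f g) xs =
     cup S (Suc p) q (coboundary S p f) g xs + (- 1) ^ p * cup S p (Suc q) f (coboundary S q g) xs"
  proof (cases "xs \<in> tuples S (p + q + 2)")
    case True
    have "diff (cup S p q f g) xs = diff (\<lambda>ys. f (take (Suc p) ys) * g (drop p ys)) xs"
      by (rule diff_cong_tuples[of _ S "p + q + 1"]) (use True in \<open>auto simp: cup_def\<close>)
    also have "\<dots> = diff f (take (Suc (Suc p)) xs) * g (drop (Suc p) xs)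
      + (- 1) ^ p * (f (take (Suc p) xs) * diff g (drop p xs))"
      by (rule diff_cup) (use True in \<open>auto simp: tuples_def\<close>)
    finally show ?thesis
      using True set_take_subset[of "Suc (Suc p)" xs] set_drop_subset[of p xs]
      by (auto simp: coboundary_eq_diff cup_def tuples_def)
  qed (auto simp: coboundary_eq_diff cup_def)
qed

lemma cup_minus_left: "cup S p q (\<lambda>xs. f xs - f' xs) g = (\<lambda>xs. cup S p q f g xs - cup S p q f' g xs)"
  by (auto simp: cup_def algebra_simps)

lemma cup_minus_right: "cup S p q f (\<lambda>xs. g xs - g' xs) = (\<lambda>xs. cup S p q f g xs - cup S p q f g' xs)"
  by (auto simp: cup_def algebra_simps)

lemma cup_zero_left: "cup S p q (\<lambda>_. 0) g = (\<lambda>_. 0)"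
  by (auto simp: cup_def)

lemma cup_zero_right: "cup S p q f (\<lambda>_. 0) = (\<lambda>_. 0)"
  by (auto simp: cup_def)

context group_action
begin

text \<open>Following the locale \<open>group_action\<close>, \<open>E\<close> is the set acted upon
  here. In \<open>weighted_graph\<close> below, \<open>V\<close> takes this place and
  \<open>E\<close> is the set of edges.\<close>

abbreviation "cochains \<equiv> bounded_cochains G \<phi> E"

lemma act_in: "g \<in> carrier G \<Longrightarrow> x \<in> E \<Longrightarrow> \<phi> g x \<in> E"
  using element_image by blast

lemma map_act_in: "g \<in> carrier G \<Longrightarrow> xs \<in> tuples E n \<Longrightarrow> map (\<phi> g) xs \<in> tuples E n"
  using act_in by (auto simp: tuples_def)

lemma inv_in: "g \<in> carrier G \<Longrightarrow> inv g \<in> carrier G"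
  by (rule group.inv_closed[OF group_hom.axioms(1)[OF group_hom]])

text \<open>Kept apart from boundedness, because the quasimorphism and the bridges below are
  invariant but possibly unbounded.\<close>

definition invariant :: "nat \<Rightarrow> ('c list \<Rightarrow> real) \<Rightarrow> bool" where
  "invariant n F \<longleftrightarrow> (\<forall>g\<in>carrier G. \<forall>xs\<in>tuples E (Suc n). F (map (\<phi> g) xs) = F xs)"

lemma cochainsI:
  assumes "\<And>xs. xs \<in> tuples E (Suc n) \<Longrightarrow> \<bar>F xs\<bar> \<le> B"
    and "\<And>g xs. g \<in> carrier G \<Longrightarrow> xs \<in> tuples E (Suc n) \<Longrightarrow> F (map (\<phi> g) xs) = F xs"
  shows "restrict_tuples E n F \<in> cochains n"
  using assms inv_in map_act_in
  by (auto simp: bounded_cochains_def restrict_tuples_def)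

lemma cochainsI':
  assumes "\<And>xs. xs \<notin> tuples E (Suc n) \<Longrightarrow> F xs = 0"
    and "\<And>xs. xs \<in> tuples E (Suc n) \<Longrightarrow> \<bar>F xs\<bar> \<le> B"
    and "invariant n F"
  shows "F \<in> cochains n"
proof -
  have "restrict_tuples E n F \<in> cochains n"
    by (rule cochainsI) (use assms(2,3) invariant_def in auto)
  moreover have "restrict_tuples E n F = F"
    by (rule ext) (simp add: restrict_tuples_def assms(1))
  ultimately show ?thesis by simp
qed

lemma cochains_outside: "f \<in> cochains n \<Longrightarrow> xs \<notin> tuples E (Suc n) \<Longrightarrow> f xs = 0"
  by (auto simp: bounded_cochains_def)

lemma cochains_bound:
  assumes "f \<in> cochains n"
  obtains B where "0 \<le> B" "\<And>xs. \<bar>f xs\<bar> \<le> B"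
proof -
  have "\<exists>B. \<forall>xs\<in>tuples E (Suc n). \<bar>f xs\<bar> \<le> B"
    using assms by (simp add: bounded_cochains_def)
  then obtain B where B: "\<And>xs. xs \<in> tuples E (Suc n) \<Longrightarrow> \<bar>f xs\<bar> \<le> B"
    by blast
  have "\<bar>f xs\<bar> \<le> max B 0" for xs
    using B[of xs] cochains_outside[OF assms, of xs] by (cases "xs \<in> tuples E (Suc n)") auto
  then show ?thesis using that[of "max B 0"] by auto
qed

lemma cochains_invariant:
  assumes "f \<in> cochains n" "g \<in> carrier G" "xs \<in> tuples E (Suc n)"
  shows "f (map (\<phi> g) xs) = f xs"
proof -
  have "inv (inv g) = g"
    by (rule group.inv_inv[OF group_hom.axioms(1)[OF group_hom] assms(2)])
  then show ?thesis
    using assms inv_in[OF assms(2)] unfolding bounded_cochains_def by force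
qed

lemma invariant_cochains: "f \<in> cochains n \<Longrightarrow> invariant n f"
  by (simp add: invariant_def cochains_invariant)

lemma invariant_add: "invariant n f \<Longrightarrow> invariant n f' \<Longrightarrow> invariant n (\<lambda>xs. f xs + f' xs)"
  by (simp add: invariant_def)

lemma invariant_minus: "invariant n f \<Longrightarrow> invariant n f' \<Longrightarrow> invariant n (\<lambda>xs. f xs - f' xs)"
  by (simp add: invariant_def)

lemma invariant_cmult: "invariant n f \<Longrightarrow> invariant n (\<lambda>xs. c * f xs)"
  by (simp add: invariant_def)

lemma invariant_coboundary:
  assumes "invariant n f"
  shows "invariant (Suc n) (coboundary E n f)"
  unfolding invariant_def
proof (intro ballI)
  fix g xs assume g: "g \<in> carrier G" and xs: "xs \<in> tuples E (Suc (Suc n))"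
  have "diff f (map (\<phi> g) xs) = diff f xs"
    unfolding diff_map
    by (rule diff_cong_tuples[OF xs]) (use assms g in \<open>simp add: invariant_def\<close>)
  then show "coboundary E n f (map (\<phi> g) xs) = coboundary E n f xs"
    using xs map_act_in[OF g xs] by (simp add: coboundary_eq_diff)
qed

lemma invariant_cup:
  assumes "invariant p f" "invariant q f'"
  shows "invariant (p + q) (cup E p q f f')"
  unfolding invariant_def
proof (intro ballI)
  fix g xs assume g: "g \<in> carrier G" and xs: "xs \<in> tuples E (Suc (p + q))"
  have "take (Suc p) xs \<in> tuples E (Suc p)" "drop p xs \<in> tuples E (Suc q)"
    using xs set_take_subset[of "Suc p" xs] set_drop_subset[of p xs] by (auto simp: tuples_def)
  then show "cup E p q f f' (map (\<phi> g) xs) = cup E p q f f' xs"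
    using g assms xs map_act_in[OF g xs] by (simp add: cup_def take_map drop_map invariant_def)
qed

lemma cochains_zero: "(\<lambda>_. 0) \<in> cochains n"
  by (auto simp: bounded_cochains_def)

lemma cochains_minus:
  assumes "f \<in> cochains n" "f' \<in> cochains n"
  shows "(\<lambda>xs. f xs - f' xs) \<in> cochains n"
proof -
  obtain B B' where B: "\<And>xs. \<bar>f xs\<bar> \<le> B" "\<And>xs. \<bar>f' xs\<bar> \<le> B'"
    using cochains_bound assms by metis
  show ?thesis
  proof (rule cochainsI'[of _ _ "B + B'"])
    show "\<bar>f xs - f' xs\<bar> \<le> B + B'" for xs
      using B(1)[of xs] B(2)[of xs] by linarith
  qed (simp_all add: assms cochains_outside[OF assms(1)] cochains_outside[OF assms(2)]
      invariant_minus invariant_cochains)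
qed

lemma cochains_cmult:
  assumes "f \<in> cochains n"
  shows "(\<lambda>xs. c * f xs) \<in> cochains n"
proof -
  obtain B where B: "\<And>xs. \<bar>f xs\<bar> \<le> B" using cochains_bound assms by metis
  show ?thesis
  proof (rule cochainsI'[of _ _ "\<bar>c\<bar> * B"])
    show "\<bar>c * f xs\<bar> \<le> \<bar>c\<bar> * B" for xs
      using B[of xs] by (simp add: abs_mult mult_left_mono)
  qed (simp_all add: assms cochains_outside[OF assms] invariant_cmult invariant_cochains)
qed

lemma cochains_add:
  assumes "f \<in> cochains n" "f' \<in> cochains n"
  shows "(\<lambda>xs. f xs + f' xs) \<in> cochains n"
  using cochains_minus[OF assms(1) cochains_cmult[OF assms(2), of "-1"]] by simp

lemma cochains_cup:
  assumes "f \<in> cochains p" "f' \<in> cochains q"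
  shows "cup E p q f f' \<in> cochains (p + q)"
proof -
  obtain B B' where B: "0 \<le> B" "0 \<le> B'" "\<And>xs. \<bar>f xs\<bar> \<le> B" "\<And>xs. \<bar>f' xs\<bar> \<le> B'"
    using cochains_bound assms by metis
  show ?thesis
  proof (rule cochainsI'[of _ _ "B * B'"])
    show "\<bar>cup E p q f f' xs\<bar> \<le> B * B'" for xs
      using B by (simp add: cup_def abs_mult mult_mono)
    show "invariant (p + q) (cup E p q f f')"
      by (intro invariant_cup invariant_cochains assms)
  qed (simp add: cup_def)
qed

lemma cochains_coboundary:
  assumes "f \<in> cochains n"
  shows "coboundary E n f \<in> cochains (Suc n)"
proof -
  obtain B where B: "\<And>xs. \<bar>f xs\<bar> \<le> B" using cochains_bound assms by metis
  show ?thesis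
  proof (rule cochainsI'[of _ _ "Suc (Suc n) * B"])
    show "\<bar>coboundary E n f xs\<bar> \<le> Suc (Suc n) * B" if "xs \<in> tuples E (Suc (Suc n))" for xs
      using diff_bound[of f B xs] B that by (auto simp: coboundary_eq_diff tuples_def)
    show "invariant (Suc n) (coboundary E n f)"
      by (intro invariant_coboundary invariant_cochains assms)
  qed (simp add: coboundary_eq_diff)
qed

section \<open>Cocycles, cohomology classes and their cup products\<close>

lemma cocycles_iff: "f \<in> cocycles G \<phi> E n \<longleftrightarrow> f \<in> cochains n \<and> coboundary E n f = (\<lambda>_. 0)"
  by (simp add: cocycles_def)

lemma coboundaries_zero: "(\<lambda>_. 0) \<in> coboundaries G \<phi> E n"
proof (cases n)
  case (Suc k)
  have "coboundary E k (\<lambda>_. 0) = (\<lambda>_. 0)"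
    by (auto simp: coboundary_eq_diff diff_zero)
  from image_eqI[of _ "coboundary E k", OF this[symmetric] cochains_zero] show ?thesis using Suc by simp
qed simp

lemma coboundaries_add:
  assumes "f \<in> coboundaries G \<phi> E n" "f' \<in> coboundaries G \<phi> E n"
  shows "(\<lambda>xs. f xs + f' xs) \<in> coboundaries G \<phi> E n"
proof (cases n)
  case (Suc k)
  then obtain b b' where "b \<in> cochains k" "b' \<in> cochains k"
    and "f = coboundary E k b" "f' = coboundary E k b'"
    using assms by auto
  then have "(\<lambda>xs. f xs + f' xs) = coboundary E k (\<lambda>xs. b xs + b' xs)"
    "(\<lambda>xs. b xs + b' xs) \<in> cochains k"
    by (simp_all only: coboundary_add cochains_add)
  from image_eqI[of _ "coboundary E k", OF this] show ?thesis using Suc by simp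
qed (use assms in simp)

lemma coboundaries_cmult:
  assumes "f \<in> coboundaries G \<phi> E n"
  shows "(\<lambda>xs. c * f xs) \<in> coboundaries G \<phi> E n"
proof (cases n)
  case (Suc k)
  then obtain b where "b \<in> cochains k" "f = coboundary E k b"
    using assms by auto
  then have "(\<lambda>xs. c * f xs) = coboundary E k (\<lambda>xs. c * b xs)"
    "(\<lambda>xs. c * b xs) \<in> cochains k"
    by (simp_all only: coboundary_cmult cochains_cmult)
  from image_eqI[of _ "coboundary E k", OF this] show ?thesis using Suc by simp
qed (use assms in simp)

lemma equiv_cohomologous: "equiv (cocycles G \<phi> E n) (cohomologous G \<phi> E n)"
proof (rule equivI)
  show "cohomologous G \<phi> E n \<subseteq> cocycles G \<phi> E n \<times> cocycles G \<phi> E n"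
    by (auto simp: cohomologous_def)
  show "refl_on (cocycles G \<phi> E n) (cohomologous G \<phi> E n)"
    using coboundaries_zero by (auto simp: refl_on_def cohomologous_def)
  show "sym (cohomologous G \<phi> E n)"
    unfolding sym_def cohomologous_def using coboundaries_cmult[of _ n "-1"] by fastforce
  show "trans (cohomologous G \<phi> E n)"
    unfolding trans_def cohomologous_def using coboundaries_add[of _ n] by fastforce
qed

lemma cohomology_class_eqI:
  assumes "f \<in> cocycles G \<phi> E n" "f' \<in> cocycles G \<phi> E n"
    and "(\<lambda>xs. f xs - f' xs) \<in> coboundaries G \<phi> E n"
  shows "cohomology_class G \<phi> E n f = cohomology_class G \<phi> E n f'"
  unfolding cohomology_class_def
  by (rule equiv_class_eq[OF equiv_cohomologous]) (use assms in \<open>simp add: cohomologous_def\<close>)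

lemma cohomology_class_mem:
  "f' \<in> cohomology_class G \<phi> E n f \<longleftrightarrow> f \<in> cocycles G \<phi> E n \<and> f' \<in> cocycles G \<phi> E n \<and>
    (\<lambda>xs. f xs - f' xs) \<in> coboundaries G \<phi> E n"
  by (auto simp: cohomology_class_def cohomologous_def)

lemma cohomology_class_self: "f \<in> cocycles G \<phi> E n \<Longrightarrow> f \<in> cohomology_class G \<phi> E n f"
  using coboundaries_zero by (simp add: cohomology_class_mem)

lemma cohomology_eq_class:
  assumes "A \<in> cohomology G \<phi> E n" "f \<in> A"
  shows "f \<in> cocycles G \<phi> E n" "A = cohomology_class G \<phi> E n f"
proof -
  obtain f' where f': "f' \<in> cocycles G \<phi> E n" "A = cohomology_class G \<phi> E n f'"
    using assms(1) unfolding cohomology_def cohomology_class_def by (auto elim: quotientE)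
  then show "f \<in> cocycles G \<phi> E n" using assms(2) by (simp add: cohomology_class_mem)
  show "A = cohomology_class G \<phi> E n f"
    using f' assms(2) cohomology_class_eqI[of f' n f] by (simp add: cohomology_class_mem)
qed

lemma zero_cocycle: "(\<lambda>_. 0) \<in> cocycles G \<phi> E n"
  by (auto simp: cocycles_iff cochains_zero coboundary_eq_diff diff_zero)

lemma coboundary_cocycle: "b \<in> cochains n \<Longrightarrow> coboundary E n b \<in> cocycles G \<phi> E (Suc n)"
  by (simp add: cocycles_iff cochains_coboundary coboundary_coboundary)

lemma class_coboundary:
  assumes "b \<in> cochains n"
  shows "cohomology_class G \<phi> E (Suc n) (coboundary E n b) = trivial_class G \<phi> E (Suc n)"
  by (rule cohomology_class_eqI[OF coboundary_cocycle[OF assms] zero_cocycle]) (use assms in auto)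

lemma cup_cocycle:
  assumes "f \<in> cocycles G \<phi> E p" "g \<in> cocycles G \<phi> E q"
  shows "cup E p q f g \<in> cocycles G \<phi> E (p + q)"
  using assms cochains_cup by (simp add: cocycles_iff coboundary_cup cup_zero_left cup_zero_right)

lemma cup_coboundary_left:
  assumes "f \<in> coboundaries G \<phi> E p" "g \<in> cocycles G \<phi> E q"
  shows "cup E p q f g \<in> coboundaries G \<phi> E (p + q)"
proof (cases p)
  case 0
  then show ?thesis using assms(1) coboundaries_zero by (simp add: cup_zero_left)
next
  case (Suc k)
  then obtain b where b: "b \<in> cochains k" "f = coboundary E k b" using assms(1) by auto
  have "cup E p q f g = coboundary E (k + q) (cup E k q b g)"
    using assms(2) b Suc by (simp add: cocycles_iff coboundary_cup cup_zero_right)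
  then show ?thesis using Suc cochains_cup[of b k g q] b assms(2) by (auto simp: cocycles_iff)
qed

lemma cup_coboundary_right:
  assumes "f \<in> cocycles G \<phi> E p" "g \<in> coboundaries G \<phi> E q"
  shows "cup E p q f g \<in> coboundaries G \<phi> E (p + q)"
proof (cases q)
  case 0
  then show ?thesis using assms(2) coboundaries_zero by (simp add: cup_zero_right)
next
  case (Suc k)
  then obtain b where b: "b \<in> cochains k" "g = coboundary E k b" using assms(2) by auto
  have "coboundary E (p + k) (cup E p k f b) = (\<lambda>xs. (- 1) ^ p * cup E p q f g xs)"
    using assms(1) b Suc by (simp add: cocycles_iff coboundary_cup cup_zero_left)
  moreover have "coboundary E (p + k) (cup E p k f b) \<in> coboundaries G \<phi> E (p + q)"
    using Suc cochains_cup[of f p b k] b assms(1) by (auto simp: cocycles_iff)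
  ultimately have "(\<lambda>xs. (- 1) ^ p * cup E p q f g xs) \<in> coboundaries G \<phi> E (p + q)" by simp
  from coboundaries_cmult[OF this, of "(- 1) ^ p"] show ?thesis
    by (simp flip: mult.assoc power_add add: mult_2[symmetric])
qed

text \<open>The representatives are exchanged one at a time, through the mixed product of
  \<open>f'\<close> and \<open>g\<close>, so that in each step the unchanged factor is a cocycle and
  the difference of the other is a coboundary.\<close>

lemma cup_class_eq:
  assumes "f \<in> cocycles G \<phi> E p" "g \<in> cocycles G \<phi> E q"
  shows "cup_class G \<phi> E p q (cohomology_class G \<phi> E p f) (cohomology_class G \<phi> E q g)
    = cohomology_class G \<phi> E (p + q) (cup E p q f g)"
proof -
  have *: "cohomology_class G \<phi> E (p + q) (cup E p q f' g') = cohomology_class G \<phi> E (p + q) (cup E p q f g)"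
    if "f' \<in> cohomology_class G \<phi> E p f" "g' \<in> cohomology_class G \<phi> E q g" for f' g'
  proof -
    have f': "f' \<in> cocycles G \<phi> E p" "(\<lambda>xs. f xs - f' xs) \<in> coboundaries G \<phi> E p"
      and g': "g' \<in> cocycles G \<phi> E q" "(\<lambda>xs. g xs - g' xs) \<in> coboundaries G \<phi> E q"
      using that by (auto simp: cohomology_class_mem)
    have "cohomology_class G \<phi> E (p + q) (cup E p q f g) = cohomology_class G \<phi> E (p + q) (cup E p q f' g)"
      using cohomology_class_eqI cup_cocycle assms f'(1) cup_coboundary_left[OF f'(2) assms(2)]
      by (simp add: cup_minus_left)
    also have "\<dots> = cohomology_class G \<phi> E (p + q) (cup E p q f' g')"
      using cohomology_class_eqI cup_cocycle assms f'(1) g'(1) cup_coboundary_right[OF f'(1) g'(2)]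
      by (simp add: cup_minus_right)
    finally show ?thesis by simp
  qed
  show ?thesis
    unfolding cup_class_def
    using * cohomology_class_self[OF assms(1)] cohomology_class_self[OF assms(2)] by blast
qed

text \<open>On a cocycle the term \<open>rev_prism (diff f)\<close> of the homotopy vanishes, so
  \<open>f\<close> and its signed reversal differ by the coboundary of the prism. The prism
  evaluates \<open>f\<close> finitely often, on entries of the given tuple, which keeps it bounded
  and invariant. The index of the sign is the number of entries in degree
  \<open>Suc n\<close>.\<close>

lemma rev_cocycle:
  assumes "f \<in> cocycles G \<phi> E (Suc n)"
  shows "restrict_tuples E (Suc n) (\<lambda>xs. rev_sign (Suc (Suc n)) * f (rev xs))
    \<in> cohomology_class G \<phi> E (Suc n) f"
proof -
  let ?b = "restrict_tuples E n (rev_prism f)"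
  have f: "f \<in> cochains (Suc n)" "\<And>xs. xs \<in> tuples E (Suc (Suc (Suc n))) \<Longrightarrow> diff f xs = 0"
  proof -
    show "f \<in> cochains (Suc n)" using assms by (simp add: cocycles_iff)
    show "diff f xs = 0" if "xs \<in> tuples E (Suc (Suc (Suc n)))" for xs
    proof -
      have "coboundary E (Suc n) f xs = 0" using assms by (simp add: cocycles_iff)
      then show ?thesis using that by (simp add: coboundary_eq_diff)
    qed
  qed
  obtain B where B: "\<And>xs. \<bar>f xs\<bar> \<le> B" using cochains_bound f by metis
  have b: "?b \<in> cochains n"
  proof (rule cochainsI)
    show "\<bar>rev_prism f xs\<bar> \<le> Suc n * B" if "xs \<in> tuples E (Suc n)" for xs
      using rev_prism_bound[of xs f B] B that by (auto simp: tuples_def)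
    show "rev_prism f (map (\<phi> g) xs) = rev_prism f xs" if "g \<in> carrier G" "xs \<in> tuples E (Suc n)" for g xs
      unfolding rev_prism_map
      by (rule rev_prism_cong)
        (use cochains_invariant[OF f(1) that(1)] that(2) in \<open>auto simp: tuples_def\<close>)
  qed
  have eq: "restrict_tuples E (Suc n) (\<lambda>xs. rev_sign (Suc (Suc n)) * f (rev xs))
      = (\<lambda>xs. f xs + coboundary E n ?b xs)"
  proof
    fix xs
    show "restrict_tuples E (Suc n) (\<lambda>xs. rev_sign (Suc (Suc n)) * f (rev xs)) xs
      = f xs + coboundary E n ?b xs"
    proof (cases "xs \<in> tuples E (Suc (Suc n))")
      case True
      have "rev_prism (diff f) xs = 0"
        by (rule rev_prism_zero) (use True f(2) in \<open>auto simp: tuples_def\<close>)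
      then have "f xs + diff (rev_prism f) xs = rev_sign (length xs) * f (rev xs)"
        using diff_rev_prism[of f xs] by simp
      then show ?thesis
        using True unfolding coboundary_restrict
        by (simp add: coboundary_eq_diff restrict_tuples_def tuples_def del: rev_sign.simps)
    next
      case False
      then show ?thesis
        using cochains_outside[OF f(1), of xs]
        by (simp add: coboundary_eq_diff restrict_tuples_def)
    qed
  qed
  have "(\<lambda>xs. f xs + coboundary E n ?b xs) \<in> cocycles G \<phi> E (Suc n)"
    using assms coboundary_cocycle[OF b] cochains_add[of f "Suc n" "coboundary E n ?b"]
    by (simp add: cocycles_iff coboundary_add)
  moreover have "coboundary E n ?b \<in> coboundaries G \<phi> E (Suc n)"
    using b by auto
  from coboundaries_cmult[OF this, of "-1"]
  have "(\<lambda>xs. f xs - (f xs + coboundary E n ?b xs)) \<in> coboundaries G \<phi> E (Suc n)" by simp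
  ultimately show ?thesis
    unfolding eq cohomology_class_mem using assms by blast
qed

end

subsection \<open>Fragments\<close>

abbreviation edge_at :: "'v list \<Rightarrow> nat \<Rightarrow> 'v \<times> 'v" where
  "edge_at p i \<equiv> (p ! i, p ! Suc i)"

lemma sorted_wrt_less_bounds:
  fixes js :: "nat list"
  assumes "sorted_wrt (<) js" "i \<in> set js"
  shows "hd js \<le> i" "i \<le> last js"
proof -
  show "hd js \<le> i" using assms by (cases js) auto
  show "i \<le> last js" using assms by (cases js rule: rev_cases) (auto simp: sorted_wrt_append)
qed

lemma fragments_edge_tuples:
  assumes "is_path V E p"
  shows "fragments l p \<subseteq> edge_tuples E l"
proof -
  have "{p ! i, p ! Suc i} \<in> E" if "i < path_length p" for i
    using assms that by (simp add: is_path_def path_length_def)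
  then show ?thesis
    by (auto simp: fragments_def edge_tuples_def oriented_edges_def)
qed

lemma fragments_subset_image:
  "fragments l p \<subseteq> map (edge_at p) ` {js. set js \<subseteq> {..<path_length p} \<and> length js = l}"
  by (auto simp: fragments_def)

lemma finite_fragments: "finite (fragments l p)"
  by (rule finite_subset[OF fragments_subset_image]) (simp add: finite_lists_length_eq)

lemma card_fragments: "card (fragments l p) \<le> path_length p ^ l"
proof -
  have "card (fragments l p) \<le> card {js. set js \<subseteq> {..<path_length p} \<and> length js = l}"
    by (rule surj_card_le[OF _ fragments_subset_image]) (simp add: finite_lists_length_eq)
  then show ?thesis by (simp add: card_lists_length_eq)
qed

lemma edge_tuple_inverse_inverse: "edge_tuple_inverse (edge_tuple_inverse a) = a"
  by (simp add: edge_tuple_inverse_def rev_map o_def)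

lemma head_inverse: "a \<noteq> [] \<Longrightarrow> head (edge_tuple_inverse a) = tail a"
  by (simp add: head_def tail_def edge_tuple_inverse_def hd_rev last_map)

lemma tail_inverse: "a \<noteq> [] \<Longrightarrow> tail (edge_tuple_inverse a) = head a"
  by (simp add: head_def tail_def edge_tuple_inverse_def last_rev hd_map)

lemma head_map: "a \<noteq> [] \<Longrightarrow> head (map (map_prod f f) a) = f (head a)"
  by (simp add: head_def hd_map)

lemma tail_map: "a \<noteq> [] \<Longrightarrow> tail (map (map_prod f f) a) = f (tail a)"
  by (simp add: tail_def last_map)

lemma fragments_rev_subset: "edge_tuple_inverse ` fragments l p \<subseteq> fragments l (rev p)"
proof
  fix b assume "b \<in> edge_tuple_inverse ` fragments l p"
  then obtain js where js: "length js = l" "sorted_wrt (<) js" "\<forall>i\<in>set js. i < path_length p"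
    and b: "b = edge_tuple_inverse (map (edge_at p) js)"
    by (auto simp: fragments_def)
  define n where "n = path_length p"
  \<comment> \<open>Edge \<open>i\<close> of \<open>p\<close> is edge \<open>n - 1 - i\<close> of
    the reversed path, traversed backwards; the outer \<open>rev\<close> makes the indices increase
    again.\<close>
  define ks where "ks = rev (map (\<lambda>i. n - 1 - i) js)"
  have "edge_at (rev p) (n - 1 - i) = prod.swap (edge_at p i)" if "i \<in> set js" for i
  proof -
    have "i < length p - 1" using js(3) that by (simp add: path_length_def)
    then show ?thesis
      by (simp add: n_def path_length_def rev_nth Suc_diff_Suc)
  qed
  then have "b = map (edge_at (rev p)) ks"
    unfolding b ks_def edge_tuple_inverse_def by (simp add: rev_map)
  moreover have "length ks = l" using js by (simp add: ks_def)
  moreover have "sorted_wrt (<) ks"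
    unfolding ks_def sorted_wrt_rev sorted_wrt_map
    by (rule sorted_wrt_mono_rel[OF _ js(2)]) (use js(3) n_def in auto)
  moreover have "\<forall>i\<in>set ks. i < path_length (rev p)"
    using js(3) by (auto simp: ks_def n_def path_length_def)
  ultimately show "b \<in> fragments l (rev p)"
    unfolding fragments_def by blast
qed

lemma fragments_rev: "fragments l (rev p) = edge_tuple_inverse ` fragments l p"
proof
  show "fragments l (rev p) \<subseteq> edge_tuple_inverse ` fragments l p"
  proof
    fix a assume "a \<in> fragments l (rev p)"
    then have "edge_tuple_inverse a \<in> fragments l p"
      using fragments_rev_subset[of l "rev p"] by auto
    then show "a \<in> edge_tuple_inverse ` fragments l p"
      by (metis edge_tuple_inverse_inverse imageI)
  qed
qed (rule fragments_rev_subset)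

lemma fragments_map: "fragments l (map f p) = map (map_prod f f) ` fragments l p"
proof -
  have eq: "map (edge_at (map f p)) js = map (map_prod f f) (map (edge_at p) js)"
    if "\<forall>i\<in>set js. i < path_length p" for js
    using that by (auto simp: path_length_def)
  show ?thesis
  proof (intro equalityI subsetI)
    fix b assume "b \<in> fragments l (map f p)"
    then obtain js where js: "length js = l" "sorted_wrt (<) js" "\<forall>i\<in>set js. i < path_length p"
      and b: "b = map (edge_at (map f p)) js"
      by (auto simp: fragments_def path_length_def)
    then have "map (edge_at p) js \<in> fragments l p" unfolding fragments_def by blast
    then show "b \<in> map (map_prod f f) ` fragments l p"
      unfolding b eq[OF js(3)] by blast
  next
    fix b assume "b \<in> map (map_prod f f) ` fragments l p"
    then obtain js where js: "length js = l" "sorted_wrt (<) js" "\<forall>i\<in>set js. i < path_length p"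
      and b: "b = map (map_prod f f) (map (edge_at p) js)"
      by (auto simp: fragments_def)
    have "\<forall>i\<in>set js. i < path_length (map f p)" using js(3) by (simp add: path_length_def)
    then show "b \<in> fragments l (map f p)"
      unfolding b eq[OF js(3), symmetric] fragments_def using js by blast
  qed
qed

text \<open>The edges of \<open>p\<close> are those of \<open>s\<close> followed by those of
  \<open>r\<close>. A fragment that lies in neither piece has an edge on each side of the junction,
  so the junction is strictly between its ends. Such fragments are the ones counted by the last
  condition on a weight.\<close>

lemma fragments_concat:
  assumes "l > 0" and "composable s r" and p: "p = path_concat s r" and "distinct p"
  shows "fragments l s \<subseteq> fragments l p" "fragments l r \<subseteq> fragments l p"
    and "fragments l s \<inter> fragments l r = {}"
    and "\<And>a. a \<in> fragments l p \<Longrightarrow> a \<notin> fragments l s \<Longrightarrow> a \<notin> fragments l r \<Longrightarrow>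
      contained_in p (last s) a"
proof -
  define k where "k = length s - 1"
  have ne: "s \<noteq> []" "r \<noteq> []" and lh: "last s = hd r" and int: "set s \<inter> set r = {last s}"
    using assms(2) by (auto simp: composable_def)
  \<comment> \<open>Dropping the shared vertex from \<open>s\<close> rather than from
    \<open>r\<close> makes the index shift for \<open>r\<close> exactly \<open>k\<close>, the number
    of edges of \<open>s\<close>.\<close>
  have p': "p = butlast s @ r"
    using ne lh unfolding p path_concat_def
    by (metis append.assoc append_Cons append_Nil append_butlast_last_id list.collapse)
  have lens: "length s = Suc k" and lenp: "path_length p = k + path_length r" "length p = k + length r"
    using ne p' by (auto simp: k_def path_length_def Suc_leI)
  have es: "edge_at p i = edge_at s i" if "i < k" for i
    using that lens unfolding p path_concat_def by (simp add: nth_append)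
  have er: "edge_at p (k + i) = edge_at r i" for i
    using lens unfolding p' by (simp add: nth_append)
  have pk: "p ! k = last s"
    using lens ne lh unfolding p' by (simp add: nth_append hd_conv_nth)
  show "fragments l s \<subseteq> fragments l p"
  proof
    fix a assume "a \<in> fragments l s"
    then obtain js where js: "length js = l" "sorted_wrt (<) js" "\<forall>i\<in>set js. i < k"
      "a = map (edge_at s) js"
      by (auto simp: fragments_def path_length_def lens)
    then have "a = map (edge_at p) js" using es by simp
    moreover have "\<forall>i\<in>set js. i < path_length p" using js(3) lenp by auto
    ultimately show "a \<in> fragments l p" using js unfolding fragments_def by blast
  qed
  show "fragments l r \<subseteq> fragments l p"
  proof
    fix a assume "a \<in> fragments l r"
    then obtain js where js: "length js = l" "sorted_wrt (<) js" "\<forall>i\<in>set js. i < path_length r"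
      "a = map (edge_at r) js"
      by (auto simp: fragments_def)
    define ks where "ks = map ((+) k) js"
    have "a = map (edge_at p) ks" using js er by (simp add: ks_def)
    moreover have "\<forall>i\<in>set ks. i < path_length p" using js(3) lenp by (auto simp: ks_def)
    moreover have "length ks = l" "sorted_wrt (<) ks" using js by (auto simp: ks_def sorted_wrt_map)
    ultimately show "a \<in> fragments l p" unfolding fragments_def by blast
  qed
  show "fragments l s \<inter> fragments l r = {}"
  proof (rule ccontr)
    assume "fragments l s \<inter> fragments l r \<noteq> {}"
    then obtain a js ks where js: "length js = l" "\<forall>i\<in>set js. i < path_length s"
        "a = map (edge_at s) js"
      and ks: "length ks = l" "\<forall>i\<in>set ks. i < path_length r" "a = map (edge_at r) ks"
      unfolding fragments_def by blast
    have nn: "js \<noteq> []" "ks \<noteq> []" using js ks assms(1) by auto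
    define i j where "i = hd js" and "j = hd ks"
    have ij: "i < k" "j < path_length r"
      using js ks nn lens by (auto simp: i_def j_def path_length_def)
    \<comment> \<open>A common fragment would have its first edge in both pieces. Both ends of that
      edge would be the only shared vertex, against distinctness; \<open>l > 0\<close> provides this
      edge.\<close>
    have "edge_at s i = edge_at r j"
      using hd_map[of js "edge_at s"] hd_map[of ks "edge_at r"] js(3) ks(3) nn
      unfolding i_def j_def by simp
    moreover have "s ! i \<in> set s" "s ! Suc i \<in> set s" "r ! j \<in> set r" "r ! Suc j \<in> set r"
      using ij lens by (auto simp: path_length_def)
    ultimately have "s ! i = last s" "s ! Suc i = last s" using int by auto
    moreover have "distinct s" using assms(4) unfolding p path_concat_def by simp
    ultimately show False using ij lens nth_eq_iff_index_eq[of s i "Suc i"] by auto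
  qed
  fix a assume a: "a \<in> fragments l p" "a \<notin> fragments l s" "a \<notin> fragments l r"
  then obtain js where js: "length js = l" "sorted_wrt (<) js" "\<forall>i\<in>set js. i < path_length p"
    "a = map (edge_at p) js"
    by (auto simp: fragments_def)
  have nn: "js \<noteq> []" using js assms(1) by auto
  have "\<not> (\<forall>i\<in>set js. i < k)"
  proof
    assume *: "\<forall>i\<in>set js. i < k"
    then have "a = map (edge_at s) js" using js(4) es by simp
    moreover have "\<forall>i\<in>set js. i < path_length s" using * lens by (simp add: path_length_def)
    ultimately show False using a(2) js unfolding fragments_def by blast
  qed
  then have last: "k \<le> last js"
    using sorted_wrt_less_bounds(2)[OF js(2)] by fastforce
  have "\<not> (\<forall>i\<in>set js. k \<le> i)"
  proof
    assume *: "\<forall>i\<in>set js. k \<le> i"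
    define ks where "ks = map (\<lambda>i. i - k) js"
    have "a = map (edge_at r) ks"
      using js(4) * by (auto simp: ks_def simp flip: er)
    moreover have "\<forall>i\<in>set ks. i < path_length r" using * js(3) lenp by (fastforce simp: ks_def)
    moreover have "length ks = l" using js by (simp add: ks_def)
    moreover have "sorted_wrt (<) ks"
      unfolding ks_def sorted_wrt_map
      by (rule sorted_wrt_mono_rel[OF _ js(2)]) (use * in \<open>auto intro: diff_less_mono\<close>)
    ultimately show False using a(3) unfolding fragments_def by blast
  qed
  then have hd: "hd js < k"
    using sorted_wrt_less_bounds(1)[OF js(2)] by fastforce
  \<comment> \<open>The first edge starts at an index below \<open>k\<close>, the last one ends at
    an index above \<open>k\<close>. Distinctness of \<open>p\<close> turns this into the
    inequalities of vertices in \<open>contained_in\<close>.\<close>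
  have "head a = p ! hd js" "tail a = p ! Suc (last js)"
    using js(4) nn by (simp_all add: head_def tail_def hd_map last_map)
  moreover have ll: "Suc (last js) < length p"
    using js(3) last_in_set[OF nn] by (force simp: path_length_def)
  moreover have "p ! hd js \<noteq> p ! k" "p ! k \<noteq> p ! Suc (last js)"
    using assms(4) hd last ll by (auto simp: nth_eq_iff_index_eq)
  ultimately show "contained_in p (last s) a"
    unfolding contained_in_def pk[symmetric] using hd last
    by (intro conjI exI[of _ "hd js"] exI[of _ k] exI[of _ "Suc (last js)"]) auto
qed

subsection \<open>Twisted weight sums\<close>

locale weighted_graph =
  fixes G :: "('g, 'b) monoid_scheme" (structure)
    and act :: "'g \<Rightarrow> 'v \<Rightarrow> 'v"
    and V :: "'v set" and E :: "'v set set"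
    and l :: nat
    and P :: "'v path_family" and Phi :: "'v fragment_family"
    and W :: "('v \<times> 'v) list \<Rightarrow> real"
  assumes graph: "simple_graph V E" and acts: "acts_on_graph G act V E"
    and l_pos: "l > 0" and pair: "coherent_pair G act V E l P Phi"
    and weight: "is_weight G act V E l P Phi W"
begin

sublocale group_action G V act
  using acts by (simp add: acts_on_graph_def)

definition path_sum :: "(('v \<times> 'v) list \<Rightarrow> real) \<Rightarrow> 'v list \<Rightarrow> real" where
  "path_sum \<psi> p = (\<Sum>a\<in>fragments l p. W a * \<psi> a)"

definition twisted_qm :: "(('v \<times> 'v) list \<Rightarrow> real) \<Rightarrow> 'v \<Rightarrow> 'v \<Rightarrow> real" where
  "twisted_qm \<psi> x y = path_sum \<psi> (SOME p. p \<in> P x y)"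

text \<open>What \<open>W\<close> times the factor must keep of a weight: path-independence (by
  stability), alternation (by symmetry under inversion) and a bound. Its support lies in that of
  \<open>W\<close>, so the counting constant of \<open>W\<close> still serves. Invariance is left
  out, as a single factor depends on a tuple of vertices; \<open>twist\<close> restores it for the
  whole family.\<close>

definition admissible :: "real \<Rightarrow> (('v \<times> 'v) list \<Rightarrow> real) \<Rightarrow> bool" where
  "admissible C \<psi> \<longleftrightarrow> stable_map V E l P Phi W \<psi> \<and>
     (\<forall>a\<in>edge_tuples E l. \<psi> (edge_tuple_inverse a) = \<psi> a \<and> \<bar>\<psi> a\<bar> \<le> C)"

lemma family: "path_family V E P"
  using pair by (simp add: coherent_pair_def coherent_def)

lemma paths:
  assumes "x \<in> V" "y \<in> V" "p \<in> P x y"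
  shows "is_path V E p" "hd p = x" "last p = y" "p \<noteq> []" "distinct p"
proof -
  show "is_path V E p" "hd p = x" "last p = y"
    using family assms by (auto simp: path_family_def)
  then show "p \<noteq> []" "distinct p" by (auto simp: is_path_def)
qed

lemma some_path: "x \<in> V \<Longrightarrow> y \<in> V \<Longrightarrow> (SOME p. p \<in> P x y) \<in> P x y"
  using family by (simp add: path_family_def some_in_eq)

lemma subpath:
  assumes "x \<in> V" "y \<in> V" "p \<in> P x y" "q \<noteq> []" "sublist q p"
  shows "q \<in> P (hd q) (last q)"
  using assms pair unfolding coherent_pair_def coherent_def by blast

lemma map_paths:
  assumes "g \<in> carrier G" "x \<in> V" "y \<in> V" "p \<in> P x y"
  shows "map (act g) p \<in> P (act g x) (act g y)"
proof -
  have "\<forall>g\<in>carrier G. \<forall>x\<in>V. \<forall>y\<in>V. map (act g) ` P x y = P (act g x) (act g y)"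
    using pair unfolding coherent_pair_def coherent_def by linarith
  then have "map (act g) ` P x y = P (act g x) (act g y)" using assms by simp
  then show ?thesis using assms(4) by (metis imageI)
qed

lemma fragments_in:
  "x \<in> V \<Longrightarrow> y \<in> V \<Longrightarrow> p \<in> P x y \<Longrightarrow> a \<in> fragments l p \<Longrightarrow> a \<in> edge_tuples E l"
  using fragments_edge_tuples paths(1) by blast

lemma edge_tuples_nonempty: "a \<in> edge_tuples E l \<Longrightarrow> a \<noteq> []"
  using l_pos by (auto simp: edge_tuples_def)

lemma edge_tuples_ends:
  assumes "a \<in> edge_tuples E l"
  shows "head a \<in> V" "tail a \<in> V"
proof -
  have "fst e \<in> V \<and> snd e \<in> V" if "e \<in> set a" for e
  proof -
    have "{fst e, snd e} \<in> E" using assms that by (auto simp: edge_tuples_def oriented_edges_def)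
    then show ?thesis using graph by (fastforce simp: simple_graph_def doubleton_eq_iff)
  qed
  then show "head a \<in> V" "tail a \<in> V"
    using edge_tuples_nonempty[OF assms] by (simp_all add: head_def tail_def)
qed

lemma path_sum_path_independent:
  assumes "stable_map V E l P Phi W \<psi>" "x \<in> V" "y \<in> V" "p \<in> P x y" "q \<in> P x y"
  shows "path_sum \<psi> p = path_sum \<psi> q"
proof -
  have bij: "bij_betw (Phi p q) (fragments l p) (fragments l q)"
    using pair assms unfolding coherent_pair_def by blast
  have "W a * \<psi> a = W (Phi p q a) * \<psi> (Phi p q a)" if a: "a \<in> fragments l p" for a
  proof -
    have W: "W a = W (Phi p q a)"
      using weight assms a unfolding is_weight_def by blast
    show ?thesis
    \<comment> \<open>Stability speaks only of the support of \<open>W\<close>. Elsewhere both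
      summands vanish, as \<open>W\<close> has the same value at \<open>a\<close> and
      \<open>Phi p q a\<close>.\<close>
    proof (cases "W a = 0")
      case False
      then have "a \<in> fragments l p \<inter> weight_supp E l W"
        using a fragments_in[OF assms(2,3,4)] by (simp add: weight_supp_def)
      then have "\<psi> a = \<psi> (Phi p q a)"
        using assms unfolding stable_map_def by blast
      then show ?thesis using W by simp
    qed (use W in simp)
  qed
  then have "path_sum \<psi> p = (\<Sum>a\<in>fragments l p. W (Phi p q a) * \<psi> (Phi p q a))"
    unfolding path_sum_def by (rule sum.cong[OF refl])
  also have "\<dots> = path_sum \<psi> q"
    unfolding path_sum_def by (rule sum.reindex_bij_betw[OF bij])
  finally show ?thesis .
qed

lemma twisted_qm_eq:
  assumes "stable_map V E l P Phi W \<psi>" "x \<in> V" "y \<in> V" "p \<in> P x y"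
  shows "twisted_qm \<psi> x y = path_sum \<psi> p"
  unfolding twisted_qm_def using path_sum_path_independent some_path assms by blast

lemma twisted_qm_cong:
  assumes "x \<in> V" "y \<in> V" "\<And>a. a \<in> edge_tuples E l \<Longrightarrow> \<psi> a = \<psi>' a"
  shows "twisted_qm \<psi> x y = twisted_qm \<psi>' x y"
  unfolding twisted_qm_def path_sum_def
  by (rule sum.cong) (use assms fragments_in[OF assms(1,2) some_path[OF assms(1,2)]] in auto)

lemma twisted_qm_cmult: "twisted_qm (\<lambda>a. c * \<psi> a) x y = c * twisted_qm \<psi> x y"
  by (simp add: twisted_qm_def path_sum_def sum_distrib_left mult.left_commute)

lemma twisted_qm_one: "twisted_qm (\<lambda>_. 1) x y = weight_qm l P W x y"
  by (simp add: twisted_qm_def path_sum_def weight_qm_def)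

lemma diff_twisted_qm: "diff (\<lambda>ys. twisted_qm (h ys) x y) xs = twisted_qm (\<lambda>a. diff (\<lambda>ys. h ys a) xs) x y"
  by (simp add: twisted_qm_def path_sum_def diff_sum diff_cmult)

lemma twisted_qm_act:
  assumes "stable_map V E l P Phi W \<psi>" "g \<in> carrier G" "x \<in> V" "y \<in> V"
  shows "twisted_qm \<psi> (act g x) (act g y) = twisted_qm (\<lambda>a. \<psi> (map (map_prod (act g) (act g)) a)) x y"
proof -
  define p where "p = (SOME p. p \<in> P x y)"
  define M where "M = map (map_prod (act g) (act g))"
  have p: "p \<in> P x y" unfolding p_def by (rule some_path[OF assms(3,4)])
  \<comment> \<open>The fragments of the translated path form the image of a set, so summing over
    them needs injectivity, which holds because edges have their ends in \<open>V\<close>.\<close>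
  have inj: "inj_on M (fragments l p)"
  proof (rule inj_onI)
    fix a b assume ab: "a \<in> fragments l p" "b \<in> fragments l p" "M a = M b"
    have sub: "set a \<subseteq> V \<times> V" if "a \<in> fragments l p" for a
    proof -
      have "set a \<subseteq> oriented_edges E"
        using fragments_in[OF assms(3,4) p that] by (simp add: edge_tuples_def)
      also have "\<dots> \<subseteq> V \<times> V"
        using graph by (fastforce simp: oriented_edges_def simple_graph_def doubleton_eq_iff)
      finally show ?thesis .
    qed
    have "inj_on (act g) V" using inj_prop assms(2) by blast
    then have "inj_on (map_prod (act g) (act g)) (V \<times> V)" by (rule map_prod_inj_on) fact
    then have "inj_on (map_prod (act g) (act g)) (set a \<union> set b)"
      using sub[OF ab(1)] sub[OF ab(2)] by (meson Un_least inj_on_subset)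
    then show "a = b" using ab(3) unfolding M_def by (rule map_inj_on[rotated])
  qed
  have "twisted_qm \<psi> (act g x) (act g y) = path_sum \<psi> (map (act g) p)"
    by (rule twisted_qm_eq) (use assms act_in map_paths p in auto)
  also have "\<dots> = (\<Sum>a\<in>fragments l p. W (M a) * \<psi> (M a))"
    unfolding path_sum_def fragments_map M_def[symmetric] by (simp add: sum.reindex[OF inj])
  also have "\<dots> = (\<Sum>a\<in>fragments l p. W a * \<psi> (M a))"
  proof (rule sum.cong[OF refl])
    fix a assume "a \<in> fragments l p"
    then have "a \<in> edge_tuples E l" using fragments_in[OF assms(3,4) p] by blast
    then show "W (M a) * \<psi> (M a) = W a * \<psi> (M a)"
      using weight assms(2) unfolding is_weight_def M_def by simp
  qed
  finally show ?thesis by (simp add: twisted_qm_def path_sum_def p_def M_def)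
qed

lemma path_sum_rev:
  assumes "admissible C \<psi>" "is_path V E p"
  shows "path_sum \<psi> (rev p) = - path_sum \<psi> p"
proof -
  have inj: "inj_on edge_tuple_inverse (fragments l p)"
    by (rule inj_on_inverseI) (rule edge_tuple_inverse_inverse)
  have "path_sum \<psi> (rev p) = (\<Sum>a\<in>fragments l p. W (edge_tuple_inverse a) * \<psi> (edge_tuple_inverse a))"
    unfolding path_sum_def fragments_rev by (simp add: sum.reindex[OF inj])
  also have "\<dots> = (\<Sum>a\<in>fragments l p. - (W a * \<psi> a))"
  proof (rule sum.cong[OF refl])
    fix a assume "a \<in> fragments l p"
    then have a: "a \<in> edge_tuples E l" using fragments_edge_tuples[OF assms(2)] by blast
    have "W (edge_tuple_inverse a) = - W a" using weight a unfolding is_weight_def by blast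
    then show "W (edge_tuple_inverse a) * \<psi> (edge_tuple_inverse a) = - (W a * \<psi> a)"
      using assms(1) a by (simp add: admissible_def)
  qed
  finally show ?thesis by (simp add: path_sum_def sum_negf)
qed

text \<open>Additivity fails only by the fragments that straddle the junction. At most
  \<open>c\<close> of them are in the support of \<open>W\<close>, and each contributes at most
  \<open>B * C\<close>.\<close>

lemma path_sum_concat_bound:
  assumes "admissible C \<psi>" and B: "\<And>a. a \<in> edge_tuples E l \<Longrightarrow> \<bar>W a\<bar> \<le> B"
    and c: "\<And>x y p m. x \<in> V \<Longrightarrow> y \<in> V \<Longrightarrow> p \<in> P x y \<Longrightarrow> m \<in> set p \<Longrightarrow>
      card ({a \<in> fragments l p. contained_in p m a} \<inter> weight_supp E l W) \<le> c"
    and xy: "x \<in> V" "y \<in> V" and p: "p \<in> P x y" "p = path_concat s r" "composable s r"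
    and "0 \<le> B" "0 \<le> C"
  shows "\<bar>path_sum \<psi> p - path_sum \<psi> s - path_sum \<psi> r\<bar> \<le> c * (B * C)"
proof -
  let ?F = "\<lambda>q. fragments l q" and ?h = "\<lambda>a. W a * \<psi> a"
  let ?K = "{a \<in> ?F p. contained_in p (last s) a} \<inter> weight_supp E l W"
  note conc = fragments_concat[OF l_pos p(3,2) paths(5)[OF xy p(1)]]
  have fin: "finite (?F q)" for q :: "'v list" by (rule finite_fragments)
  have "s \<noteq> []" using p(3) by (simp add: composable_def)
  then have sp: "last s \<in> set p" unfolding p(2) path_concat_def by simp
  have bound: "\<bar>?h a\<bar> \<le> B * C" if "a \<in> ?F p" for a
    using B[OF fragments_in[OF xy p(1) that]] fragments_in[OF xy p(1) that] assms(1,9,10)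
    by (simp add: abs_mult mult_mono admissible_def)
  have "sum ?h (?F p) = sum ?h (?F s \<union> ?F r) + sum ?h (?F p - (?F s \<union> ?F r))"
    using sum.subset_diff[OF Un_least[OF conc(1,2)] fin, of ?h] by simp
  also have "sum ?h (?F s \<union> ?F r) = sum ?h (?F s) + sum ?h (?F r)"
    by (rule sum.union_disjoint) (use conc(3) fin in auto)
  also have "sum ?h (?F p - (?F s \<union> ?F r)) = sum ?h (?K - (?F s \<union> ?F r))"
  proof (rule sum.mono_neutral_right)
    show "\<forall>a\<in>?F p - (?F s \<union> ?F r) - (?K - (?F s \<union> ?F r)). ?h a = 0"
    proof
      fix a assume a: "a \<in> ?F p - (?F s \<union> ?F r) - (?K - (?F s \<union> ?F r))"
      then have "contained_in p (last s) a" using conc(4) by blast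
      then have "a \<notin> weight_supp E l W" using a by blast
      moreover have "a \<in> edge_tuples E l" using a fragments_in[OF xy p(1)] by blast
      ultimately show "?h a = 0" by (simp add: weight_supp_def)
    qed
  qed (use fin in auto)
  finally have eq: "path_sum \<psi> p - path_sum \<psi> s - path_sum \<psi> r = sum ?h (?K - (?F s \<union> ?F r))"
    by (simp add: path_sum_def)
  have "\<bar>sum ?h (?K - (?F s \<union> ?F r))\<bar> \<le> (\<Sum>a\<in>?K - (?F s \<union> ?F r). \<bar>?h a\<bar>)" by (rule sum_abs)
  also have "\<dots> \<le> (\<Sum>a\<in>?K - (?F s \<union> ?F r). B * C)" by (rule sum_mono) (use bound in auto)
  also have "\<dots> = card (?K - (?F s \<union> ?F r)) * (B * C)" by simp
  also have "\<dots> \<le> c * (B * C)"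
  proof (rule mult_right_mono)
    have "card (?K - (?F s \<union> ?F r)) \<le> card ?K" by (rule card_mono) (use fin in auto)
    also have "\<dots> \<le> c" by (rule c[OF xy p(1) sp])
    finally show "real (card (?K - (?F s \<union> ?F r))) \<le> real c" by simp
    show "0 \<le> B * C" using assms(9,10) by simp
  qed
  finally show ?thesis unfolding eq .
qed

lemma path_sum_bound:
  assumes "admissible C \<psi>" and B: "\<And>a. a \<in> edge_tuples E l \<Longrightarrow> \<bar>W a\<bar> \<le> B"
    and "is_path V E p" "path_length p \<le> R" and "0 \<le> B" "0 \<le> C"
  shows "\<bar>path_sum \<psi> p\<bar> \<le> real R ^ l * (B * C)"
proof -
  have bound: "\<bar>W a * \<psi> a\<bar> \<le> B * C" if "a \<in> fragments l p" for a
    using B[of a] fragments_edge_tuples[OF assms(3)] that assms(1,5,6)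
    by (auto simp: abs_mult admissible_def intro!: mult_mono)
  have "\<bar>path_sum \<psi> p\<bar> \<le> (\<Sum>a\<in>fragments l p. \<bar>W a * \<psi> a\<bar>)"
    unfolding path_sum_def by (rule sum_abs)
  also have "\<dots> \<le> (\<Sum>a\<in>fragments l p. B * C)" by (rule sum_mono) (use bound in auto)
  also have "\<dots> = card (fragments l p) * (B * C)" by simp
  also have "\<dots> \<le> real R ^ l * (B * C)"
  proof (rule mult_right_mono)
    have "card (fragments l p) \<le> R ^ l"
      using card_fragments power_mono[OF assms(4)] le_trans by blast
    then show "real (card (fragments l p)) \<le> real R ^ l"
      by (metis of_nat_le_iff of_nat_power)
    show "0 \<le> B * C" using assms by simp
  qed
  finally show ?thesis .
qed

text \<open>
  On a quasi-median triangle the three outer legs cancel in pairs, and only boundedly many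
  fragments lie on the short middle paths or straddle a junction.
\<close>

lemma twisted_qm_defect:
  obtains D where "0 \<le> D" "\<And>C \<psi> x y z. admissible C \<psi> \<Longrightarrow> 0 \<le> C \<Longrightarrow> x \<in> V \<Longrightarrow> y \<in> V \<Longrightarrow> z \<in> V \<Longrightarrow>
    \<bar>twisted_qm \<psi> y z - twisted_qm \<psi> x z + twisted_qm \<psi> x y\<bar> \<le> D * C"
proof -
  obtain B0 where "\<forall>a\<in>edge_tuples E l. \<bar>W a\<bar> \<le> B0"
    using weight unfolding is_weight_def by blast
  \<comment> \<open>Without any edge tuple, \<open>B0\<close> could be negative.\<close>
  define B where "B = max B0 0"
  have B: "0 \<le> B" "\<And>a. a \<in> edge_tuples E l \<Longrightarrow> \<bar>W a\<bar> \<le> B"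
    unfolding B_def using \<open>\<forall>a\<in>edge_tuples E l. \<bar>W a\<bar> \<le> B0\<close> by force+
  obtain c :: nat where c: "\<And>x y p m. x \<in> V \<Longrightarrow> y \<in> V \<Longrightarrow> p \<in> P x y \<Longrightarrow> m \<in> set p \<Longrightarrow>
      card ({a \<in> fragments l p. contained_in p m a} \<inter> weight_supp E l W) \<le> c"
    using weight unfolding is_weight_def by blast
  have "\<exists>R. quasi_median_for V P R"
    using pair by (simp add: coherent_pair_def coherent_def)
  then obtain R where R: "quasi_median_for V P R" ..
  \<comment> \<open>Each of the three sides has two junctions, at most \<open>c\<close> fragments
    each, and one middle path with at most \<open>R ^ l\<close> fragments. The factor
    \<open>C\<close> stays outside: \<open>D\<close> must not depend on the twist.\<close>
  define D where "D = (6 * real c + 3 * real R ^ l) * B"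
  show ?thesis
  proof (rule that[of D])
    show "0 \<le> D" using B(1) by (simp add: D_def)
    fix C \<psi> x y z
    assume adm: "admissible C \<psi>" and C: "0 \<le> C" and xyz: "x \<in> V" "y \<in> V" "z \<in> V"
    have dec: "\<bar>path_sum \<psi> p - (path_sum \<psi> s - path_sum \<psi> t)\<bar> \<le> (2 * real c + real R ^ l) * (B * C)"
      if "x \<in> V" "y \<in> V" "p \<in> P x y" "decomposes p s r (rev t)" "path_length r \<le> R"
        "x' \<in> V" "y' \<in> V" "r \<in> P x' y'" "u \<in> V" "v \<in> V" "t \<in> P u v"
      for x y p s r t x' y' u v
    proof -
      have d: "composable s r" "composable (path_concat s r) (rev t)"
          "p = path_concat (path_concat s r) (rev t)"
        using that(4) by (auto simp: decomposes_def)
      let ?q = "path_concat s r"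
      \<comment> \<open>The first two pieces form a subpath, which therefore belongs to
        \<open>P\<close> itself, so the counting bound also applies to its inner junction.\<close>
      have q: "?q \<noteq> []" "sublist ?q p" using d by (auto simp: path_concat_def composable_def)
      have "set ?q \<subseteq> V"
        using paths(1)[OF that(1-3)] set_mono_sublist[OF q(2)] by (auto simp: is_path_def)
      then have qV: "hd ?q \<in> V" "last ?q \<in> V" using q(1) by (meson hd_in_set last_in_set subsetD)+
      have 1: "\<bar>path_sum \<psi> p - path_sum \<psi> ?q - path_sum \<psi> (rev t)\<bar> \<le> c * (B * C)"
        by (rule path_sum_concat_bound[OF adm B(2) c that(1-3) d(3,2) B(1) C])
      have 2: "\<bar>path_sum \<psi> ?q - path_sum \<psi> s - path_sum \<psi> r\<bar> \<le> c * (B * C)"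
        by (rule path_sum_concat_bound[OF adm B(2) c qV subpath[OF that(1-3) q] refl d(1) B(1) C])
      have 3: "\<bar>path_sum \<psi> r\<bar> \<le> real R ^ l * (B * C)"
        by (rule path_sum_bound[OF adm B(2) paths(1)[OF that(6-8)] that(5) B(1) C])
      have 4: "path_sum \<psi> (rev t) = - path_sum \<psi> t"
        by (rule path_sum_rev[OF adm paths(1)[OF that(9-11)]])
      have "(2 * real c + real R ^ l) * (B * C) = c * (B * C) + c * (B * C) + real R ^ l * (B * C)"
        by (simp add: algebra_simps)
      then show ?thesis using 1 2 3 4 by linarith
    qed
    obtain mx my mz pxy pyz pxz sx sy sz r1 r2 r3 where
      m: "mx \<in> V" "my \<in> V" "mz \<in> V" and
      p: "pxy \<in> P x y" "pyz \<in> P y z" "pxz \<in> P x z" and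
      s: "sx \<in> P x mx" "sy \<in> P y my" "sz \<in> P z mz" and
      r: "r1 \<in> P mx my" "r2 \<in> P my mz" "r3 \<in> P mx mz" and
      d: "decomposes pxy sx r1 (rev sy)" "decomposes pyz sy r2 (rev sz)" "decomposes pxz sx r3 (rev sz)"
      and len: "path_length r1 \<le> R" "path_length r2 \<le> R" "path_length r3 \<le> R"
      using R[unfolded quasi_median_for_def, rule_format, OF xyz] by blast
    have st: "stable_map V E l P Phi W \<psi>" using adm by (simp add: admissible_def)
    note eqs = twisted_qm_eq[OF st xyz(1,2) p(1)] twisted_qm_eq[OF st xyz(2,3) p(2)]
      twisted_qm_eq[OF st xyz(1,3) p(3)]
    have "\<bar>path_sum \<psi> pxy - (path_sum \<psi> sx - path_sum \<psi> sy)\<bar> \<le> (2 * real c + real R ^ l) * (B * C)"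
      by (rule dec[OF xyz(1,2) p(1) d(1) len(1) m(1,2) r(1) xyz(2) m(2) s(2)])
    moreover have "\<bar>path_sum \<psi> pyz - (path_sum \<psi> sy - path_sum \<psi> sz)\<bar> \<le> (2 * real c + real R ^ l) * (B * C)"
      by (rule dec[OF xyz(2,3) p(2) d(2) len(2) m(2,3) r(2) xyz(3) m(3) s(3)])
    moreover have "\<bar>path_sum \<psi> pxz - (path_sum \<psi> sx - path_sum \<psi> sz)\<bar> \<le> (2 * real c + real R ^ l) * (B * C)"
      by (rule dec[OF xyz(1,3) p(3) d(3) len(3) m(1,3) r(3) xyz(3) m(3) s(3)])
    moreover have "D * C = 3 * ((2 * real c + real R ^ l) * (B * C))"
      by (simp add: D_def algebra_simps)
    ultimately show "\<bar>twisted_qm \<psi> y z - twisted_qm \<psi> x z + twisted_qm \<psi> x y\<bar> \<le> D * C"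
      unfolding eqs by linarith
  qed
qed

end

context weighted_graph
begin

subsection \<open>Primitives\<close>

definition end_mean :: "('v \<Rightarrow> real) \<Rightarrow> ('v \<times> 'v) list \<Rightarrow> real" where
  "end_mean h a = (h (head a) + h (tail a)) / 2"

text \<open>One bound for all tuples, and equivariance jointly in the tuple and the fragment: this
  makes the cochains built from \<open>u\<close> uniformly controlled and invariant although a
  single \<open>u ys\<close> need not be invariant.\<close>

definition twist :: "nat \<Rightarrow> ('v list \<Rightarrow> ('v \<times> 'v) list \<Rightarrow> real) \<Rightarrow> bool" where
  "twist n u \<longleftrightarrow> (\<exists>C\<ge>0. \<forall>ys\<in>tuples V n. admissible C (u ys)) \<and>
     (\<forall>g\<in>carrier G. \<forall>ys\<in>tuples V n. \<forall>a\<in>edge_tuples E l.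
        u (map (act g) ys) (map (map_prod (act g) (act g)) a) = u ys a)"

abbreviation defect :: "(('v \<times> 'v) list \<Rightarrow> real) \<Rightarrow> 'v \<Rightarrow> 'v \<Rightarrow> 'v \<Rightarrow> real" where
  "defect \<psi> x y z \<equiv> twisted_qm \<psi> y z - twisted_qm \<psi> x z + twisted_qm \<psi> x y"

text \<open>
  For \<open>xs = (x\<^sub>0, \<dots>, x\<^sub>N)\<close> this is the sum, over the fragments \<open>a\<close> of a path from \<open>x\<^sub>n\<^sub>-\<^sub>1\<close> to \<open>x\<^sub>n\<close>,
  of \<open>W a\<close> times \<open>u (x\<^sub>0, \<dots>, x\<^sub>n\<^sub>-\<^sub>1) a \<cdot> v (x\<^sub>n, \<dots>, x\<^sub>N) a\<close>.
\<close>

definition bridge ::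
  "nat \<Rightarrow> ('v list \<Rightarrow> ('v \<times> 'v) list \<Rightarrow> real) \<Rightarrow> ('v list \<Rightarrow> ('v \<times> 'v) list \<Rightarrow> real) \<Rightarrow> 'v list \<Rightarrow> real" where
  "bridge n u v xs =
     twisted_qm (\<lambda>a. u (take n xs) a * v (drop n xs) a) (last (take n xs)) (hd (drop n xs))"

lemma admissible_one: "admissible 1 (\<lambda>_. 1)"
  by (simp add: admissible_def stable_map_def)

lemma admissible_mult:
  assumes "admissible C \<psi>" "admissible C' \<psi>'" "0 \<le> C"
  shows "admissible (C * C') (\<lambda>a. \<psi> a * \<psi>' a)"
proof -
  have "stable_map V E l P Phi W (\<lambda>a. \<psi> a * \<psi>' a)"
    using assms(1,2) unfolding admissible_def stable_map_def by metis
  then show ?thesis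
    using assms by (simp add: admissible_def abs_mult mult_mono)
qed

lemma twist_one: "twist n (\<lambda>_ _. 1)"
  using admissible_one by (auto simp: twist_def intro!: exI[of _ 1])

text \<open>
  Averaging over both ends of a fragment makes the twist invariant under reversal, so that the
  twisted weight is again alternating.
\<close>

lemma twist_end_mean:
  assumes "\<And>ys. ys \<in> tuples V n \<Longrightarrow> stable_map V E l P Phi W (\<lambda>a. h ys (head a))"
    and "\<And>ys. ys \<in> tuples V n \<Longrightarrow> stable_map V E l P Phi W (\<lambda>a. h ys (tail a))"
    and bound: "\<And>ys v. \<bar>h ys v\<bar> \<le> C"
    and inv: "\<And>g ys v. g \<in> carrier G \<Longrightarrow> ys \<in> tuples V n \<Longrightarrow> v \<in> V \<Longrightarrow>
      h (map (act g) ys) (act g v) = h ys v"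
  shows "twist n (\<lambda>ys. end_mean (h ys))"
  unfolding twist_def
proof (intro conjI exI[of _ C] ballI)
  show "0 \<le> C" using bound[of undefined undefined] by linarith
  fix ys assume ys: "ys \<in> tuples V n"
  have "stable_map V E l P Phi W (end_mean (h ys))"
    using assms(1,2)[OF ys] unfolding stable_map_def end_mean_def by metis
  moreover have "end_mean (h ys) (edge_tuple_inverse a) = end_mean (h ys) a" if "a \<in> edge_tuples E l" for a
    using edge_tuples_nonempty[OF that] by (simp add: end_mean_def head_inverse tail_inverse)
  moreover have "\<bar>end_mean (h ys) a\<bar> \<le> C" for a
  proof -
    have "\<bar>h ys (head a) + h ys (tail a)\<bar> \<le> 2 * C"
      using bound[of ys "head a"] bound[of ys "tail a"] by linarith
    then show ?thesis by (simp add: end_mean_def)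
  qed
  ultimately show "admissible C (end_mean (h ys))"
    by (simp add: admissible_def)
next
  fix g ys a assume "g \<in> carrier G" "ys \<in> tuples V n" "a \<in> edge_tuples E l"
  then show "end_mean (h (map (act g) ys)) (map (map_prod (act g) (act g)) a) = end_mean (h ys) a"
    by (simp add: end_mean_def head_map tail_map edge_tuples_nonempty edge_tuples_ends inv)
qed

lemma diff_end_mean: "diff (\<lambda>ys. end_mean (h ys) a) xs =
    (diff (\<lambda>ys. h ys (head a)) xs + diff (\<lambda>ys. h ys (tail a)) xs) / 2"
  unfolding end_mean_def divide_inverse diff_cmult_right diff_add ..

text \<open>The differentials of \<open>u\<close> and \<open>v\<close> are assumed independent of
  the fragment, so \<open>c1\<close> and \<open>c2\<close> leave the sums. The other terms come from
  the faces that move an end of the path: omitting \<open>x\<close> joins \<open>last y\<close> to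
  \<open>hd z\<close>, and \<open>diff_last\<close> and \<open>diff_hd\<close> supply the paths that
  start or end at \<open>x\<close>. With the face that \<open>diff_split\<close> subtracts, they
  form the defect of the triangle \<open>last y\<close>, \<open>x\<close>,
  \<open>hd z\<close>.\<close>

lemma diff_bridge:
  assumes "y \<noteq> []" "z \<noteq> []" and V: "last y \<in> V" "x \<in> V" "hd z \<in> V"
    and u: "\<And>a. a \<in> edge_tuples E l \<Longrightarrow> diff (\<lambda>ys. u ys a) (y @ [x]) = c1"
    and v: "\<And>a. a \<in> edge_tuples E l \<Longrightarrow> diff (\<lambda>zs. v zs a) (x # z) = c2"
  shows "diff (bridge (length y) u v) (y @ x # z) = c1 * twisted_qm (v z) x (hd z)
    + (- 1) ^ length y * (c2 * twisted_qm (u y) (last y) x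
        - defect (\<lambda>a. u y a * v z a) (last y) x (hd z))"
proof -
  define h where "h = (\<lambda>ys zs. twisted_qm (\<lambda>a. u ys a * v zs a) (last ys) (hd zs))"
  let ?\<psi> = "\<lambda>a. u y a * v z a"
  have "bridge (length y) u v = (\<lambda>ys. h (take (length y) ys) (drop (length y) ys))"
    by (rule ext) (simp add: bridge_def h_def)
  then have "diff (bridge (length y) u v) (y @ x # z) = diff (\<lambda>ys. h ys z) (y @ [x])
      + (- 1) ^ length y * (diff (\<lambda>zs. h y zs) (x # z) - h y z)"
    using diff_split[of "length y" "y @ x # z" h] by (simp del: diff.simps)
  also have "diff (\<lambda>ys. h ys z) (y @ [x]) = diff (\<lambda>ys. twisted_qm (\<lambda>a. u ys a * v z a) x (hd z)) (y @ [x])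
      + (- 1) ^ length y * (twisted_qm ?\<psi> (last y) (hd z) - twisted_qm ?\<psi> x (hd z))"
    unfolding h_def by (rule diff_last) fact
  also have "diff (\<lambda>zs. h y zs) (x # z) = diff (\<lambda>zs. twisted_qm (\<lambda>a. u y a * v zs a) (last y) x) (x # z)
      + twisted_qm ?\<psi> (last y) (hd z) - twisted_qm ?\<psi> (last y) x"
    unfolding h_def by (rule diff_hd)
  also have "diff (\<lambda>ys. twisted_qm (\<lambda>a. u ys a * v z a) x (hd z)) (y @ [x]) = c1 * twisted_qm (v z) x (hd z)"
    unfolding diff_twisted_qm diff_cmult_right twisted_qm_cmult[symmetric]
    by (rule twisted_qm_cong) (use V u in auto)
  also have "diff (\<lambda>zs. twisted_qm (\<lambda>a. u y a * v zs a) (last y) x) (x # z)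
      = c2 * twisted_qm (u y) (last y) x"
    unfolding diff_twisted_qm diff_cmult twisted_qm_cmult[symmetric]
    by (rule twisted_qm_cong) (use V v in \<open>auto simp del: diff.simps\<close>)
  finally show ?thesis by (simp add: h_def algebra_simps)
qed

lemma tuples_take_drop:
  assumes "xs \<in> tuples V (n + m)"
  shows "take n xs \<in> tuples V n" "drop n xs \<in> tuples V m"
  using assms set_take_subset[of n xs] set_drop_subset[of n xs] by (auto simp: tuples_def)

lemma tuples_ends:
  assumes "xs \<in> tuples V (Suc n)"
  shows "xs \<noteq> []" "hd xs \<in> V" "last xs \<in> V"
proof -
  show "xs \<noteq> []" using assms by (auto simp: tuples_def)
  then show "hd xs \<in> V" "last xs \<in> V" using assms by (auto simp: tuples_def)
qed

lemma tuples_splitE: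
  assumes "xs \<in> tuples V (Suc (n + m))"
  obtains y x z where "xs = y @ x # z" "y \<in> tuples V n" "x \<in> V" "z \<in> tuples V m"
proof -
  have "n < length xs" using assms by (simp add: tuples_def)
  then have "xs = take n xs @ xs ! n # drop (Suc n) xs" by (rule id_take_nth_drop)
  moreover have "take n xs \<in> tuples V n" by (rule tuples_take_drop(1)[of _ _ "Suc m"]) (use assms in simp)
  moreover have "xs ! n \<in> V" using assms by (auto simp: tuples_def)
  moreover have "drop (Suc n) xs \<in> tuples V m" by (rule tuples_take_drop(2)) (use assms in simp)
  ultimately show ?thesis by (rule that)
qed

lemma twist_productE:
  assumes "twist n u" "twist m v"
  obtains C where "0 \<le> C"
    "\<And>y z. y \<in> tuples V n \<Longrightarrow> z \<in> tuples V m \<Longrightarrow> admissible C (\<lambda>a. u y a * v z a)"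
proof -
  obtain C C' where C: "0 \<le> C" "0 \<le> C'" "\<forall>ys\<in>tuples V n. admissible C (u ys)"
    "\<forall>ys\<in>tuples V m. admissible C' (v ys)"
    using assms unfolding twist_def by blast
  show ?thesis
    by (rule that[of "C * C'"]) (use C admissible_mult in auto)
qed

lemma invariant_bridge:
  assumes u: "twist (Suc n) u" and v: "twist (Suc m) v"
  shows "invariant (n + Suc m) (bridge (Suc n) u v)"
  unfolding invariant_def
proof (intro ballI)
  fix g xs assume g: "g \<in> carrier G" and xs: "xs \<in> tuples V (Suc (n + Suc m))"
  have y: "take (Suc n) xs \<in> tuples V (Suc n)" and z: "drop (Suc n) xs \<in> tuples V (Suc m)"
    using tuples_take_drop[of xs "Suc n" "Suc m"] xs by simp_all
  define y z where "y = take (Suc n) xs" and "z = drop (Suc n) xs"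
  have y: "y \<in> tuples V (Suc n)" "map (act g) y \<in> tuples V (Suc n)"
    and z: "z \<in> tuples V (Suc m)" "map (act g) z \<in> tuples V (Suc m)"
    using y z map_act_in[OF g] by (simp_all add: y_def z_def)
  let ?\<psi> = "\<lambda>a. u (map (act g) y) a * v (map (act g) z) a"
  have st: "stable_map V E l P Phi W ?\<psi>"
    using twist_productE[OF u v] y z unfolding admissible_def by metis
  have "bridge (Suc n) u v (map (act g) xs) = twisted_qm ?\<psi> (act g (last y)) (act g (hd z))"
    using tuples_ends(1)[OF y(1)] tuples_ends(1)[OF z(1)]
    by (simp add: bridge_def y_def z_def take_map drop_map last_map hd_map)
  also have "\<dots> = twisted_qm (\<lambda>a. ?\<psi> (map (map_prod (act g) (act g)) a)) (last y) (hd z)"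
    by (rule twisted_qm_act[OF st g]) (use tuples_ends y z in auto)
  also have "\<dots> = twisted_qm (\<lambda>a. u y a * v z a) (last y) (hd z)"
    by (rule twisted_qm_cong) (use tuples_ends y z u v g in \<open>auto simp: twist_def\<close>)
  finally show "bridge (Suc n) u v (map (act g) xs) = bridge (Suc n) u v xs"
    by (simp add: bridge_def y_def z_def)
qed

text \<open>The factor varies with \<open>y\<close> and \<open>z\<close>, so this uses that
  \<open>D\<close> in \<open>twisted_qm_defect\<close> serves all factors at once and that
  \<open>C\<close> is common to all tuples.\<close>

lemma defect_bound:
  assumes "twist (Suc n) u" "twist (Suc m) v"
  shows "\<exists>B. \<forall>y\<in>tuples V (Suc n). \<forall>x\<in>V. \<forall>z\<in>tuples V (Suc m).
    \<bar>defect (\<lambda>a. u y a * v z a) (last y) x (hd z)\<bar> \<le> B"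
proof -
  obtain C where C: "0 \<le> C"
    "\<And>y z. y \<in> tuples V (Suc n) \<Longrightarrow> z \<in> tuples V (Suc m) \<Longrightarrow> admissible C (\<lambda>a. u y a * v z a)"
    using twist_productE[OF assms] by metis
  obtain D where "\<And>C \<psi> x y z. admissible C \<psi> \<Longrightarrow> 0 \<le> C \<Longrightarrow> x \<in> V \<Longrightarrow> y \<in> V \<Longrightarrow> z \<in> V \<Longrightarrow>
      \<bar>defect \<psi> x y z\<bar> \<le> D * C"
    using twisted_qm_defect by metis
  then show ?thesis
    using C tuples_ends by (intro exI[of _ "D * C"] ballI) blast
qed

section \<open>The weight cocycle and primitives of its cup products\<close>

abbreviation qm :: "'v list \<Rightarrow> real" where
  "qm \<equiv> \<lambda>xs. weight_qm l P W (xs ! 0) (xs ! Suc 0)"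

abbreviation qm_cocycle :: "'v list \<Rightarrow> real" where
  "qm_cocycle \<equiv> weight_cocycle V l P W"

lemma invariant_qm: "invariant (Suc 0) qm"
  unfolding invariant_def
proof (intro ballI)
  fix g xs assume g: "g \<in> carrier G" and xs: "xs \<in> tuples V (Suc (Suc 0))"
  obtain x y where xy: "xs = [x, y]" "x \<in> V" "y \<in> V"
    using xs by (auto simp: tuples_def length_Suc_conv)
  have "stable_map V E l P Phi W (\<lambda>_. 1)" by (simp add: stable_map_def)
  from twisted_qm_act[OF this g xy(2,3)] show "qm (map (act g) xs) = qm xs"
    by (simp add: xy(1) twisted_qm_one)
qed

text \<open>\<open>coboundary_cocycle\<close> does not apply, as \<open>qm\<close> may be unbounded.
  The bound is the triangle defect for the constant factor 1.\<close>

lemma qm_cocycle: "qm_cocycle \<in> cocycles G act V 2"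
proof -
  obtain D where D: "\<And>x y z. x \<in> V \<Longrightarrow> y \<in> V \<Longrightarrow> z \<in> V \<Longrightarrow> \<bar>defect (\<lambda>_. 1) x y z\<bar> \<le> D * 1"
    using twisted_qm_defect admissible_one zero_le_one by metis
  have "coboundary V (Suc 0) qm \<in> cochains (Suc (Suc 0))"
  proof (rule cochainsI')
    fix xs assume xs: "xs \<in> tuples V (Suc (Suc (Suc 0)))"
    then obtain x y z where xyz: "xs = [x, y, z]" "x \<in> V" "y \<in> V" "z \<in> V"
      by (auto simp: tuples_def length_Suc_conv)
    then show "\<bar>coboundary V (Suc 0) qm xs\<bar> \<le> D"
      using D[of x y z] xs by (simp add: coboundary_eq_diff twisted_qm_one)
  qed (simp_all add: coboundary_eq_diff invariant_coboundary invariant_qm)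
  then show ?thesis
    by (simp add: cocycles_iff weight_cocycle_def numeral_2_eq_2 coboundary_coboundary)
qed

text \<open>The signed cup product with \<open>qm\<close> already has the required coboundary.
  Subtracting another coboundary preserves this, and by \<open>diff_bridge\<close> the bridge has
  the same differential up to a bounded defect.\<close>

definition left_primitive :: "nat \<Rightarrow> ('v list \<Rightarrow> ('v \<times> 'v) list \<Rightarrow> real) \<Rightarrow> ('v list \<Rightarrow> real) \<Rightarrow> 'v list \<Rightarrow> real" where
  "left_primitive n u w = (\<lambda>xs. (- 1) ^ n * cup V n (Suc 0) w qm xs
     - coboundary V n (bridge n u (\<lambda>_ _. 1)) xs)"

text \<open>The bridge is added here, because its front block has one entry and the sign in
  \<open>diff_bridge\<close> is -1.\<close>

definition right_primitive :: "nat \<Rightarrow> ('v list \<Rightarrow> ('v \<times> 'v) list \<Rightarrow> real) \<Rightarrow> ('v list \<Rightarrow> real) \<Rightarrow> 'v list \<Rightarrow> real" where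
  "right_primitive m v w = (\<lambda>xs. cup V (Suc 0) m qm w xs
     + coboundary V m (bridge (Suc 0) (\<lambda>_ _. 1) v) xs)"

lemma left_primitive:
  assumes w: "w \<in> cocycles G act V (Suc n)" and u: "twist (Suc n) u"
    and diff_u: "\<And>xs a. xs \<in> tuples V (Suc (Suc n)) \<Longrightarrow> a \<in> edge_tuples E l \<Longrightarrow>
      diff (\<lambda>ys. u ys a) xs = (- 1) ^ Suc n * w xs"
  shows "left_primitive (Suc n) u w \<in> cochains (Suc (Suc n))"
    and "coboundary V (Suc (Suc n)) (left_primitive (Suc n) u w) = cup V (Suc n) 2 w qm_cocycle"
proof -
  obtain B where B: "\<forall>y\<in>tuples V (Suc n). \<forall>x\<in>V. \<forall>z\<in>tuples V (Suc 0).
      \<bar>defect (\<lambda>a. u y a * 1) (last y) x (hd z)\<bar> \<le> B"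
    using defect_bound[OF u twist_one[of "Suc 0"]] ..
  show "left_primitive (Suc n) u w \<in> cochains (Suc (Suc n))"
  proof (rule cochainsI')
    show "left_primitive (Suc n) u w xs = 0" if "xs \<notin> tuples V (Suc (Suc (Suc n)))" for xs
      using that by (simp add: left_primitive_def cup_def coboundary_eq_diff)
    fix xs assume xs: "xs \<in> tuples V (Suc (Suc (Suc n)))"
    then obtain y x z where yxz: "xs = y @ x # z" "y \<in> tuples V (Suc n)" "x \<in> V" "z \<in> tuples V (Suc 0)"
      using tuples_splitE[of xs "Suc n" "Suc 0"] by auto
    obtain t where z: "z = [t]" "t \<in> V" using yxz(4) by (auto simp: tuples_def length_Suc_conv)
    have len: "length y = Suc n" using yxz(2) by (simp add: tuples_def)
    have yx: "y @ [x] \<in> tuples V (Suc (Suc n))" using yxz by (auto simp: tuples_def)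
    have "diff (bridge (Suc n) u (\<lambda>_ _. 1)) xs = (- 1) ^ Suc n * w (y @ [x]) * weight_qm l P W x t
        - (- 1) ^ Suc n * defect (\<lambda>a. u y a * 1) (last y) x (hd z)"
      unfolding yxz(1) len[symmetric] twisted_qm_one[symmetric]
      \<comment> \<open>The second constant is 0: the differential of the constant 1 on a pair is 1
        - 1.\<close>
      by (subst diff_bridge[of y z x u "(- 1) ^ length y * w (y @ [x])" "\<lambda>_ _. 1" 0])
        (use yxz z tuples_ends[OF yxz(2)] diff_u[OF yx] len in \<open>auto simp: algebra_simps\<close>)
    then have "left_primitive (Suc n) u w xs = (- 1) ^ Suc n * defect (\<lambda>a. u y a * 1) (last y) x (hd z)"
      using xs len by (simp add: left_primitive_def cup_def coboundary_eq_diff yxz(1) z(1))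
    then show "\<bar>left_primitive (Suc n) u w xs\<bar> \<le> B"
      using B[rule_format, OF yxz(2,3,4)] by (simp add: abs_mult)
  next
    have "invariant (Suc n) w" using w by (simp add: cocycles_iff invariant_cochains)
    from invariant_cup[OF this invariant_qm] have 1: "invariant (Suc (Suc n)) (cup V (Suc n) (Suc 0) w qm)"
      by simp
    have "invariant (Suc n) (bridge (Suc n) u (\<lambda>_ _. 1))"
      using invariant_bridge[OF u twist_one, of 0] by simp
    from invariant_coboundary[OF this] 1 show "invariant (Suc (Suc n)) (left_primitive (Suc n) u w)"
      unfolding left_primitive_def by (intro invariant_minus invariant_cmult)
  qed
  have "coboundary V (Suc n) w = (\<lambda>_. 0)" using w by (simp add: cocycles_iff)
  then have 1: "coboundary V (Suc (Suc n)) (cup V (Suc n) (Suc 0) w qm)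
      = (\<lambda>xs. (- 1) ^ Suc n * cup V (Suc n) 2 w qm_cocycle xs)"
    using coboundary_cup[of V "Suc n" "Suc 0" w qm]
    by (simp add: cup_zero_left weight_cocycle_def numeral_2_eq_2)
  have sq: "(- 1) ^ k * ((- 1) ^ k * r) = r" for r :: real and k
    by (simp only: mult.assoc[symmetric] power_mult_distrib[symmetric]) simp
  show "coboundary V (Suc (Suc n)) (left_primitive (Suc n) u w) = cup V (Suc n) 2 w qm_cocycle"
    unfolding left_primitive_def coboundary_minus coboundary_cmult coboundary_coboundary 1 sq by simp
qed

lemma right_primitive:
  assumes w: "w \<in> cocycles G act V (Suc m)" and v: "twist (Suc m) v"
    and diff_v: "\<And>xs a. xs \<in> tuples V (Suc (Suc m)) \<Longrightarrow> a \<in> edge_tuples E l \<Longrightarrow>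
      diff (\<lambda>ys. v ys a) xs = w xs"
  shows "right_primitive (Suc m) v w \<in> cochains (Suc (Suc m))"
    and "coboundary V (Suc (Suc m)) (right_primitive (Suc m) v w) = cup V 2 (Suc m) qm_cocycle w"
proof -
  obtain B where B: "\<forall>y\<in>tuples V (Suc 0). \<forall>x\<in>V. \<forall>z\<in>tuples V (Suc m).
      \<bar>defect (\<lambda>a. 1 * v z a) (last y) x (hd z)\<bar> \<le> B"
    using defect_bound[OF twist_one[of "Suc 0"] v] ..
  show "right_primitive (Suc m) v w \<in> cochains (Suc (Suc m))"
  proof (rule cochainsI')
    show "right_primitive (Suc m) v w xs = 0" if "xs \<notin> tuples V (Suc (Suc (Suc m)))" for xs
      using that by (simp add: right_primitive_def cup_def coboundary_eq_diff)
    fix xs assume xs: "xs \<in> tuples V (Suc (Suc (Suc m)))"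
    then obtain y x z where yxz: "xs = y @ x # z" "y \<in> tuples V (Suc 0)" "x \<in> V" "z \<in> tuples V (Suc m)"
      using tuples_splitE[of xs "Suc 0" "Suc m"] by auto
    obtain t where y: "y = [t]" "t \<in> V" using yxz(2) by (auto simp: tuples_def length_Suc_conv)
    have xz: "x # z \<in> tuples V (Suc (Suc m))" using yxz by (auto simp: tuples_def)
    have "diff (bridge (length y) (\<lambda>_ _. 1) v) (y @ x # z) = - (w (x # z) * weight_qm l P W t x)
        + defect (\<lambda>a. 1 * v z a) (last y) x (hd z)"
      unfolding twisted_qm_one[symmetric]
      by (subst diff_bridge[of y z x "\<lambda>_ _. 1" 0 v "w (x # z)"])
        (use yxz y tuples_ends[OF yxz(4)] diff_v[OF xz] in \<open>auto simp del: diff.simps(2)\<close>, simp_all)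
    then have "right_primitive (Suc m) v w xs = defect (\<lambda>a. 1 * v z a) (last y) x (hd z)"
      using xs by (simp add: right_primitive_def cup_def coboundary_eq_diff yxz(1) y(1) del: diff.simps)
    then show "\<bar>right_primitive (Suc m) v w xs\<bar> \<le> B"
      using B[rule_format, OF yxz(2,3,4)] by simp
  next
    have "invariant (Suc m) w" using w by (simp add: cocycles_iff invariant_cochains)
    from invariant_cup[OF invariant_qm this] have 1: "invariant (Suc (Suc m)) (cup V (Suc 0) (Suc m) qm w)"
      by simp
    have "invariant (Suc m) (bridge (Suc 0) (\<lambda>_ _. 1) v)"
      using invariant_bridge[OF twist_one v, of 0] by simp
    from invariant_coboundary[OF this] 1 show "invariant (Suc (Suc m)) (right_primitive (Suc m) v w)"
      unfolding right_primitive_def by (intro invariant_add)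
  qed
  have "coboundary V (Suc m) w = (\<lambda>_. 0)" using w by (simp add: cocycles_iff)
  then have "coboundary V (Suc (Suc m)) (cup V (Suc 0) (Suc m) qm w) = cup V 2 (Suc m) qm_cocycle w"
    using coboundary_cup[of V "Suc 0" "Suc m" qm w]
    by (simp add: cup_zero_right weight_cocycle_def numeral_2_eq_2)
  then show "coboundary V (Suc (Suc m)) (right_primitive (Suc m) v w) = cup V 2 (Suc m) qm_cocycle w"
    by (simp add: right_primitive_def coboundary_add coboundary_coboundary)
qed

text \<open>Insert the definitions of the two primitives: the triple products of \<open>w1\<close>,
  \<open>qm\<close> and \<open>w2\<close> cancel, and since \<open>w1\<close> and \<open>w2\<close>
  are closed, the remainder is the coboundary of \<open>w1\<close> cup \<open>\<eta>2\<close> plus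
  \<open>\<eta>1\<close> cup \<open>w2\<close>. This sum may be unbounded, but up to sign and a
  defect it is the coboundary of the doubly twisted bridge \<open>\<kappa>\<close>.\<close>

lemma massey_primitive:
  assumes w1: "w1 \<in> cocycles G act V (Suc n)" and w2: "w2 \<in> cocycles G act V (Suc m)"
    and u: "twist (Suc n) u" and v: "twist (Suc m) v"
    and diff_u: "\<And>xs a. xs \<in> tuples V (Suc (Suc n)) \<Longrightarrow> a \<in> edge_tuples E l \<Longrightarrow>
      diff (\<lambda>ys. u ys a) xs = (- 1) ^ Suc n * w1 xs"
    and diff_v: "\<And>xs a. xs \<in> tuples V (Suc (Suc m)) \<Longrightarrow> a \<in> edge_tuples E l \<Longrightarrow>
      diff (\<lambda>ys. v ys a) xs = w2 xs"
  shows "\<exists>b\<in>cochains (Suc n + Suc m). coboundary V (Suc n + Suc m) b = (\<lambda>xs.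
      (- 1) ^ Suc n * cup V (Suc n) (Suc (Suc m)) w1 (right_primitive (Suc m) v w2) xs
      - cup V (Suc (Suc n)) (Suc m) (left_primitive (Suc n) u w1) w2 xs)"
proof -
  define \<eta>1 where "\<eta>1 = bridge (Suc n) u (\<lambda>_ _. 1)"
  define \<eta>2 where "\<eta>2 = bridge (Suc 0) (\<lambda>_ _. 1) v"
  define \<kappa> where "\<kappa> = bridge (Suc n) u v"
  \<comment> \<open>Adding a multiple of the coboundary of \<open>\<kappa>\<close> does not change
    the coboundary of \<open>b\<close>; by \<open>diff_bridge\<close> it reduces the values of
    \<open>b\<close> to the defect for the product of both twists.\<close>
  define b where "b = (\<lambda>xs. cup V (Suc n) (Suc m) w1 \<eta>2 xs + cup V (Suc n) (Suc m) \<eta>1 w2 xs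
    - (- 1) ^ Suc n * coboundary V (n + Suc m) \<kappa> xs)"
  obtain B where B: "\<forall>y\<in>tuples V (Suc n). \<forall>x\<in>V. \<forall>z\<in>tuples V (Suc m).
      \<bar>defect (\<lambda>a. u y a * v z a) (last y) x (hd z)\<bar> \<le> B"
    using defect_bound[OF u v] ..
  have sq: "(- 1) ^ k * ((- 1) ^ k * r) = r" for r :: real and k
    by (simp only: mult.assoc[symmetric] power_mult_distrib[symmetric]) simp
  have "b \<in> cochains (Suc n + Suc m)"
  proof (rule cochainsI')
    show "b xs = 0" if "xs \<notin> tuples V (Suc (Suc n + Suc m))" for xs
      using that by (simp add: b_def cup_def coboundary_eq_diff)
    fix xs assume xs: "xs \<in> tuples V (Suc (Suc n + Suc m))"
    then obtain y x z where yxz: "xs = y @ x # z" "y \<in> tuples V (Suc n)" "x \<in> V" "z \<in> tuples V (Suc m)"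
      by (rule tuples_splitE)
    have len: "length y = Suc n" using yxz(2) by (simp add: tuples_def)
    have yx: "y @ [x] \<in> tuples V (Suc (Suc n))" and xz: "x # z \<in> tuples V (Suc (Suc m))"
      using yxz by (auto simp: tuples_def)
    note ends = tuples_ends[OF yxz(2)] tuples_ends[OF yxz(4)]
    have "diff \<kappa> xs = (- 1) ^ Suc n * w1 (y @ [x]) * twisted_qm (v z) x (hd z)
        + (- 1) ^ length y * (w2 (x # z) * twisted_qm (u y) (last y) x
          - defect (\<lambda>a. u y a * v z a) (last y) x (hd z))"
      unfolding yxz(1) \<kappa>_def len[symmetric]
      by (rule diff_bridge[OF ends(1,4,3) yxz(3) ends(5)])
        (simp_all only: diff_u[OF yx] diff_v[OF xz] len)
    then have "diff \<kappa> xs = (- 1) ^ Suc n * (w1 (y @ [x]) * twisted_qm (v z) x (hd z)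
        + w2 (x # z) * twisted_qm (u y) (last y) x - defect (\<lambda>a. u y a * v z a) (last y) x (hd z))"
      by (simp add: len algebra_simps)
    then have "(- 1) ^ Suc n * diff \<kappa> xs = w1 (y @ [x]) * twisted_qm (v z) x (hd z)
        + w2 (x # z) * twisted_qm (u y) (last y) x - defect (\<lambda>a. u y a * v z a) (last y) x (hd z)"
      by (simp only: sq)
    moreover have "cup V (Suc n) (Suc m) w1 \<eta>2 xs = w1 (y @ [x]) * twisted_qm (v z) x (hd z)"
      using xs len by (simp add: cup_def yxz(1) \<eta>2_def bridge_def)
    moreover have "cup V (Suc n) (Suc m) \<eta>1 w2 xs = w2 (x # z) * twisted_qm (u y) (last y) x"
      using xs len by (simp add: cup_def yxz(1) \<eta>1_def bridge_def)
    moreover have "coboundary V (n + Suc m) \<kappa> xs = diff \<kappa> xs"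
      using xs by (simp add: coboundary_eq_diff)
    ultimately have "b xs = defect (\<lambda>a. u y a * v z a) (last y) x (hd z)"
      by (simp add: b_def)
    then show "\<bar>b xs\<bar> \<le> B" using B[rule_format, OF yxz(2,3,4)] by simp
  next
    have "invariant (Suc n) w1" "invariant (Suc m) w2"
      using w1 w2 by (simp_all add: cocycles_iff invariant_cochains)
    moreover have "invariant (Suc n) \<eta>1"
      using invariant_bridge[OF u twist_one, of 0] by (simp add: \<eta>1_def)
    moreover have "invariant (Suc m) \<eta>2"
      using invariant_bridge[OF twist_one v, of 0] by (simp add: \<eta>2_def)
    moreover have "invariant (Suc n + Suc m) (coboundary V (n + Suc m) \<kappa>)"
      using invariant_coboundary[OF invariant_bridge[OF u v]] by (simp add: \<kappa>_def)
    ultimately show "invariant (Suc n + Suc m) b"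
      unfolding b_def by (intro invariant_minus invariant_add invariant_cmult invariant_cup)
  qed
  moreover have "coboundary V (Suc n + Suc m) b = (\<lambda>xs.
      (- 1) ^ Suc n * cup V (Suc n) (Suc (Suc m)) w1 (right_primitive (Suc m) v w2) xs
      - cup V (Suc (Suc n)) (Suc m) (left_primitive (Suc n) u w1) w2 xs)"
  proof
    fix xs
    have \<delta>: "coboundary V (Suc n) w1 = (\<lambda>_. 0)" "coboundary V (Suc m) w2 = (\<lambda>_. 0)"
      using w1 w2 by (simp_all add: cocycles_iff)
    have 1: "coboundary V (Suc n + Suc m) (cup V (Suc n) (Suc m) w1 \<eta>2) xs
        = (- 1) ^ Suc n * cup V (Suc n) (Suc (Suc m)) w1 (coboundary V (Suc m) \<eta>2) xs"
      unfolding coboundary_cup \<delta> cup_zero_left by simp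
    have 2: "coboundary V (Suc n + Suc m) (cup V (Suc n) (Suc m) \<eta>1 w2) xs
        = cup V (Suc (Suc n)) (Suc m) (coboundary V (Suc n) \<eta>1) w2 xs"
      unfolding coboundary_cup \<delta> cup_zero_right by simp
    have 3: "coboundary V (Suc n + Suc m) (coboundary V (n + Suc m) \<kappa>) xs = 0"
      by (simp add: coboundary_coboundary)
    \<comment> \<open>Associativity of the cup product, which makes the two triple products
      cancel.\<close>
    have assoc: "cup V (Suc n) (Suc (Suc m)) w1 (cup V (Suc 0) (Suc m) qm w2) xs
        = cup V (Suc (Suc n)) (Suc m) (cup V (Suc n) (Suc 0) w1 qm) w2 xs"
    proof (cases "xs \<in> tuples V (Suc (Suc (Suc (n + Suc m))))")
      case True
      then have "take (Suc (Suc (Suc n))) xs \<in> tuples V (Suc (Suc (Suc n)))"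
        "drop (Suc n) xs \<in> tuples V (Suc (Suc (Suc m)))"
        using tuples_take_drop[of xs "Suc (Suc (Suc n))" "Suc m"]
          tuples_take_drop[of xs "Suc n" "Suc (Suc (Suc m))"] by simp_all
      then show ?thesis
        using True by (simp add: cup_def tuples_def drop_take min_def)
    qed (simp add: cup_def)
    have R: "cup V (Suc n) (Suc (Suc m)) w1 (right_primitive (Suc m) v w2) xs
        = cup V (Suc n) (Suc (Suc m)) w1 (cup V (Suc 0) (Suc m) qm w2) xs
          + cup V (Suc n) (Suc (Suc m)) w1 (coboundary V (Suc m) \<eta>2) xs"
      by (simp add: right_primitive_def \<eta>2_def cup_def[of _ "Suc n" "Suc (Suc m)"] algebra_simps)
    have L: "cup V (Suc (Suc n)) (Suc m) (left_primitive (Suc n) u w1) w2 xs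
        = (- 1) ^ Suc n * cup V (Suc (Suc n)) (Suc m) (cup V (Suc n) (Suc 0) w1 qm) w2 xs
          - cup V (Suc (Suc n)) (Suc m) (coboundary V (Suc n) \<eta>1) w2 xs"
      by (simp add: left_primitive_def \<eta>1_def cup_def[of _ "Suc (Suc n)" "Suc m"] algebra_simps)
    show "coboundary V (Suc n + Suc m) b xs =
      (- 1) ^ Suc n * cup V (Suc n) (Suc (Suc m)) w1 (right_primitive (Suc m) v w2) xs
      - cup V (Suc (Suc n)) (Suc m) (left_primitive (Suc n) u w1) w2 xs"
      unfolding b_def coboundary_minus coboundary_add coboundary_cmult 1 2 3 R L assoc
      by (simp add: algebra_simps)
  qed
  ultimately show ?thesis by blast
qed

section \<open>Twists obtained from stable cocycles\<close>

lemma cocycle_diff: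
  assumes "w \<in> cocycles G act V n" "xs \<in> tuples V (n + 2)"
  shows "diff w xs = 0"
proof -
  have "coboundary V n w xs = 0" using assms(1) by (simp add: cocycles_iff)
  then show ?thesis using assms(2) by (simp add: coboundary_eq_diff)
qed

text \<open>Closedness of \<open>w\<close> on \<open>xs @ [x]\<close> makes the differential of
  \<open>w\<close> with last argument \<open>x\<close> equal to \<open>w\<close> up to sign, for
  every vertex \<open>x\<close>. The mean over the two ends of a fragment thus has a differential
  that no longer sees the fragment, as \<open>diff_bridge\<close> requires.\<close>

lemma twist_last:
  assumes w: "w \<in> cocycles G act V n"
    and st: "\<And>ys. ys \<in> tuples V n \<Longrightarrow> stable_map V E l P Phi W (\<lambda>a. w (ys @ [head a]))"
      "\<And>ys. ys \<in> tuples V n \<Longrightarrow> stable_map V E l P Phi W (\<lambda>a. w (ys @ [tail a]))"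
  shows "twist n (\<lambda>ys. end_mean (\<lambda>x. w (ys @ [x])))"
    and "\<And>xs a. xs \<in> tuples V (Suc n) \<Longrightarrow> a \<in> edge_tuples E l \<Longrightarrow>
      diff (\<lambda>ys. end_mean (\<lambda>x. w (ys @ [x])) a) xs = (- 1) ^ n * w xs"
proof -
  have co: "w \<in> cochains n" using w by (simp add: cocycles_iff)
  obtain C where C: "\<And>xs. \<bar>w xs\<bar> \<le> C" using cochains_bound[OF co] by metis
  show "twist n (\<lambda>ys. end_mean (\<lambda>x. w (ys @ [x])))"
  proof (rule twist_end_mean[OF st C])
    fix g ys x assume "g \<in> carrier G" "ys \<in> tuples V n" "x \<in> V"
    then show "w (map (act g) ys @ [act g x]) = w (ys @ [x])"
      using cochains_invariant[OF co, of g "ys @ [x]"] by (simp add: tuples_def)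
  qed
  fix xs a assume xs: "xs \<in> tuples V (Suc n)" and a: "a \<in> edge_tuples E l"
  have "diff (\<lambda>ys. w (ys @ [x])) xs = (- 1) ^ n * w xs" if "x \<in> V" for x
    using cocycle_diff[OF w, of "xs @ [x]"] xs that by (simp add: tuples_def diff_snoc)
  then show "diff (\<lambda>ys. end_mean (\<lambda>x. w (ys @ [x])) a) xs = (- 1) ^ n * w xs"
    using edge_tuples_ends[OF a] by (simp add: diff_end_mean)
qed

lemma twist_first:
  assumes w: "w \<in> cocycles G act V n" and st: "stable_cochain V E l P Phi W n w"
  shows "twist n (\<lambda>ys. end_mean (\<lambda>x. w (x # ys)))"
    and "\<And>xs a. xs \<in> tuples V (Suc n) \<Longrightarrow> a \<in> edge_tuples E l \<Longrightarrow>
      diff (\<lambda>ys. end_mean (\<lambda>x. w (x # ys)) a) xs = w xs"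
proof -
  have co: "w \<in> cochains n" using w by (simp add: cocycles_iff)
  obtain C where C: "\<And>xs. \<bar>w xs\<bar> \<le> C" using cochains_bound[OF co] by metis
  show "twist n (\<lambda>ys. end_mean (\<lambda>x. w (x # ys)))"
  proof (rule twist_end_mean[OF _ _ C])
    fix g ys x assume "g \<in> carrier G" "ys \<in> tuples V n" "x \<in> V"
    then show "w (act g x # map (act g) ys) = w (x # ys)"
      using cochains_invariant[OF co, of g "x # ys"] by (simp add: tuples_def)
  qed (use st in \<open>simp_all add: stable_cochain_def\<close>)
  fix xs a assume xs: "xs \<in> tuples V (Suc n)" and a: "a \<in> edge_tuples E l"
  have "diff (\<lambda>ys. w (x # ys)) xs = w xs" if "x \<in> V" for x
    using cocycle_diff[OF w, of "x # xs"] xs that by (simp add: tuples_def)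
  then show "diff (\<lambda>ys. end_mean (\<lambda>x. w (x # ys)) a) xs = w xs"
    using edge_tuples_ends[OF a] by (simp add: diff_end_mean)
qed

text \<open>Stability concerns the first argument; reversal moves it to the last one.\<close>

lemma stable_class_last:
  assumes A: "A \<in> cohomology G act V (Suc n)" and st: "stable_class V E l P Phi W (Suc n) A"
  obtains w where "w \<in> A"
    "\<And>ys. ys \<in> tuples V (Suc n) \<Longrightarrow> stable_map V E l P Phi W (\<lambda>a. w (ys @ [head a]))"
    "\<And>ys. ys \<in> tuples V (Suc n) \<Longrightarrow> stable_map V E l P Phi W (\<lambda>a. w (ys @ [tail a]))"
proof -
  obtain \<zeta> where \<zeta>: "\<zeta> \<in> A" "stable_cochain V E l P Phi W (Suc n) \<zeta>"
    using st unfolding stable_class_def by blast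
  define w where "w = restrict_tuples V (Suc n) (\<lambda>xs. rev_sign (Suc (Suc n)) * \<zeta> (rev xs))"
  show ?thesis
  proof (rule that[of w])
    show "w \<in> A"
      using rev_cocycle[OF cohomology_eq_class(1)[OF A \<zeta>(1)]] cohomology_eq_class(2)[OF A \<zeta>(1)]
      by (simp add: w_def)
    fix ys assume ys: "ys \<in> tuples V (Suc n)"
    then have "rev ys \<in> tuples V (Suc n)" by (simp add: tuples_def)
    then have s: "stable_map V E l P Phi W (\<lambda>a. \<zeta> (head a # rev ys))"
      "stable_map V E l P Phi W (\<lambda>a. \<zeta> (tail a # rev ys))"
      using \<zeta>(2) by (simp_all add: stable_cochain_def)
    \<comment> \<open>For \<open>x\<close> outside \<open>V\<close> both sides of the equation
      \<open>w\<close> below are 0, so it can be rewritten for arbitrary \<open>head a\<close> and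
      \<open>tail a\<close>.\<close>
    have out: "\<zeta> (x # rev ys) = 0" if "x \<notin> V" for x
      using that cohomology_eq_class(1)[OF A \<zeta>(1)] ys
      by (auto simp: cocycles_iff tuples_def intro!: cochains_outside)
    have w: "w (ys @ [x]) = rev_sign (Suc (Suc n)) * \<zeta> (x # rev ys)" for x
      using ys out[of x] by (auto simp: w_def restrict_tuples_def tuples_def)
    show "stable_map V E l P Phi W (\<lambda>a. w (ys @ [head a]))"
      "stable_map V E l P Phi W (\<lambda>a. w (ys @ [tail a]))"
      using s unfolding w stable_map_def by metis+
  qed
qed

end

theorem mainTheorem1:
  fixes G :: "('g, 'b) monoid_scheme"
    and act :: "'g \<Rightarrow> 'v \<Rightarrow> 'v"
    and V :: "'v set" and E :: "'v set set"
    and l n m :: nat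
    and P :: "'v path_family" and Phi :: "'v fragment_family"
    and W :: "('v \<times> 'v) list \<Rightarrow> real"
    and A1 A2 :: "('v list \<Rightarrow> real) set"
  assumes "simple_graph V E" and "acts_on_graph G act V E"
    and "l > 0" and "coherent_pair G act V E l P Phi"
    and "is_weight G act V E l P Phi W"
    and "n > 0" and "m > 0"
    and "A1 \<in> cohomology G act V n" and "stable_class V E l P Phi W n A1"
    and "A2 \<in> cohomology G act V m" and "stable_class V E l P Phi W m A2"
  shows "cup_class G act V n 2 A1 (cohomology_class G act V 2 (weight_cocycle V l P W))
           = trivial_class G act V (n + 2)
    \<and> cup_class G act V 2 m (cohomology_class G act V 2 (weight_cocycle V l P W)) A2
           = trivial_class G act V (m + 2)
    \<and> trivial_class G act V (n + m + 1) \<in>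
        massey_product G act V n 2 m A1 (cohomology_class G act V 2 (weight_cocycle V l P W)) A2"
proof -
  interpret weighted_graph G act V E l P Phi W
    using assms(1-5) by unfold_locales
  \<comment> \<open>A bridge starts at the last entry of one tuple and ends at the first entry of
    another, so both must be non-empty. In degree 0 the constant 1 is a stable cocycle, and its cup
    product with \<open>qm_cocycle\<close> is \<open>qm_cocycle\<close> itself.\<close>
  obtain n' m' where nm: "n = Suc n'" "m = Suc m'"
    using assms(6,7) by (metis Suc_pred')
  obtain w1 where w1: "w1 \<in> A1"
    and st1: "\<And>ys. ys \<in> tuples V n \<Longrightarrow> stable_map V E l P Phi W (\<lambda>a. w1 (ys @ [head a]))"
      "\<And>ys. ys \<in> tuples V n \<Longrightarrow> stable_map V E l P Phi W (\<lambda>a. w1 (ys @ [tail a]))"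
    using stable_class_last assms(8,9) unfolding nm by metis
  obtain w2 where w2: "w2 \<in> A2" and st2: "stable_cochain V E l P Phi W m w2"
    using assms(11) unfolding stable_class_def by blast
  note c1 = cohomology_eq_class[OF assms(8) w1] and c2 = cohomology_eq_class[OF assms(10) w2]
  define u where "u = (\<lambda>ys. end_mean (\<lambda>x. w1 (ys @ [x])))"
  define v where "v = (\<lambda>ys. end_mean (\<lambda>x. w2 (x # ys)))"
  have u: "twist n u" "\<And>xs a. xs \<in> tuples V (Suc n) \<Longrightarrow> a \<in> edge_tuples E l \<Longrightarrow>
      diff (\<lambda>ys. u ys a) xs = (- 1) ^ n * w1 xs"
    unfolding u_def by (rule twist_last[OF c1(1) st1]; assumption)+
  have v: "twist m v" "\<And>xs a. xs \<in> tuples V (Suc m) \<Longrightarrow> a \<in> edge_tuples E l \<Longrightarrow>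
      diff (\<lambda>ys. v ys a) xs = w2 xs"
    unfolding v_def by (rule twist_first[OF c2(1) st2]; assumption)+
  define b1 where "b1 = left_primitive n u w1"
  define b2 where "b2 = right_primitive m v w2"
  have b1: "b1 \<in> cochains (Suc n)" "coboundary V (Suc n) b1 = cup V n 2 w1 qm_cocycle"
    using left_primitive[OF c1(1)[unfolded nm] u[unfolded nm]] by (simp_all add: b1_def nm)
  have b2: "b2 \<in> cochains (Suc m)" "coboundary V (Suc m) b2 = cup V 2 m qm_cocycle w2"
    using right_primitive[OF c2(1)[unfolded nm] v[unfolded nm]] by (simp_all add: b2_def nm)
  have 1: "cup_class G act V n 2 A1 (cohomology_class G act V 2 qm_cocycle) = trivial_class G act V (n + 2)"
    using class_coboundary[OF b1(1)] cup_class_eq[OF c1(1) qm_cocycle] b1(2) c1(2) by simp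
  have 2: "cup_class G act V 2 m (cohomology_class G act V 2 qm_cocycle) A2 = trivial_class G act V (m + 2)"
    using class_coboundary[OF b2(1)] cup_class_eq[OF qm_cocycle c2(1)] b2(2) c2(2) by simp
  \<comment> \<open>The representative in \<open>massey_product\<close> for \<open>k = 2\<close>,
    where the outer sign is 1 and the primitives have degrees \<open>n + 1\<close> and
    \<open>m + 1\<close>.\<close>
  define r where "r = (\<lambda>xs. (- 1) ^ n * cup V n (Suc m) w1 b2 xs - cup V (Suc n) m b1 w2 xs)"
  obtain b where "b \<in> cochains (n + m)" "coboundary V (n + m) b = r"
    using massey_primitive[OF c1(1)[unfolded nm] c2(1)[unfolded nm] u(1)[unfolded nm] v(1)[unfolded nm] u(2)[unfolded nm] v(2)[unfolded nm]]
    unfolding r_def b1_def b2_def nm by blast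
  then have "trivial_class G act V (n + m + 1) = cohomology_class G act V (n + m + 1) r"
    using class_coboundary[of b "n + m"] by simp
  moreover have "cohomology_class G act V (n + m + 1) r
      \<in> massey_product G act V n 2 m A1 (cohomology_class G act V 2 qm_cocycle) A2"
    unfolding massey_product_def
    by (intro CollectI exI[of _ w1] exI[of _ qm_cocycle] exI[of _ w2] exI[of _ b1] exI[of _ b2])
      (use w1 w2 b1 b2 cohomology_class_self[OF qm_cocycle] in \<open>simp add: r_def\<close>)
  ultimately show ?thesis using 1 2 by simp
qed

end
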